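(* Let $\alpha>0$ and let $X_\alpha=\{X_\alpha(t),t\in[0,1]\}$ be an $\alpha$-permanental process, with continuous sample paths, with kernel $u(s,t)$ and sigma function $\sigma(s,t)$. Suppose there is an increasing function $\varphi$ such that $\sigma(s,t)\le\varphi(|t-s|)$ for all $s,t\in[0,1]$, $$\int_0^{1/2}\frac{\varphi(u)}{u(\log 1/u)^{1/2}}\,du<\infty,$$ and $\varphi$ is regularly varying at zero with positive index. Then $$\limsup_{h\to0}\sup_{0\le t\le h}\frac{|X_\alpha(t)-X_\alpha(0)|}{\varphi(h)(\log\log 1/h)^{1/2}}\le 2X_\alpha^{1/2}(0)\qquad a.s.$$ If $u(0,0)=0$ and if, in addition to the conditions on $\varphi$ above, $\varphi^2(h)=O(u(h,h))$ (as $h\to0$), then $$\limsup_{t\to0}\frac{X_\alpha(t)}{u(t,t)\log\log 1/t}\le1\qquad a.s.$$ and $$\limsup_{h\to0}\sup_{0\le t\le h}\frac{X_\alpha(t)}{u^*(h,h)\log\log 1/h}\le1\qquad a.s.,$$ where $u^*(h,h)=\sup_{t\le h}u(t,t)$.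
   Context: For $\alpha>0$, a random vector $(X_1,\dots,X_n)$ with nonnegative components is $\alpha$-permanental with kernel $U$ (a real $n\times n$ matrix) if $E\big(e^{-\sum_{i=1}^n s_iX_i}\big)=|I+US|^{-\alpha}$ for every diagonal matrix $S$ with positive diagonal entries $s_1,\dots,s_n$, where $|\cdot|$ denotes the determinant. A stochastic process $\{X_\alpha(t),t\in\mathcal T\}$ is an $\alpha$-permanental process with kernel $\{u(s,t),s,t\in\mathcal T\}$ if for all $t_1,\dots,t_n\in\mathcal T$ the vector $(X_\alpha(t_1),\dots,X_\alpha(t_n))$ is $\alpha$-permanental with kernel $\{u(t_i,t_j)\}_{i,j=1}^n$. Its sigma function is $\sigma(s,t)=\big(u(s,s)+u(t,t)-2(u(s,t)u(t,s))^{1/2}\big)^{1/2}$ (all quantities under the square roots are known to be nonnegative). Standing assumption on kernels: $\sup_{t\le\delta}u(t,t)>0$ for all $\delta>0$. *)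

theory Defs
  imports
    "HOL-Probability.Probability"
    "HOL-Library.Landau_Symbols"
    "Jordan_Normal_Form.Determinant"
begin

text \<open>
  The order n of the kernel matrices varies inside the definition of a process, so the
  determinant is the one on carrier-based matrices, qualified below since
  \<open>HOL-Analysis\<close> also provides a \<open>det\<close>.

  Positivity of the determinant need not be required separately. The expectation is positive
  and \<open>0 powr a = 0\<close>, so the determinant never vanishes; it is continuous in the positive
  scalars s and tends to 1 as they tend to 0, hence is positive throughout.
\<close>

definition permanental_vector ::
  "'a measure \<Rightarrow> real \<Rightarrow> nat \<Rightarrow> (nat \<Rightarrow> 'a \<Rightarrow> real) \<Rightarrow> real mat \<Rightarrow> bool" where
  "permanental_vector M \<alpha> n X U \<longleftrightarrow>
     U \<in> carrier_mat n n \<and>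
     (\<forall>i<n. X i \<in> borel_measurable M \<and> (\<forall>\<omega>\<in>space M. 0 \<le> X i \<omega>)) \<and>
     (\<forall>s. (\<forall>i<n. 0 < s i) \<longrightarrow>
        (\<integral>\<omega>. exp (- (\<Sum>i<n. s i * X i \<omega>)) \<partial>M)
          = Determinant.det (1\<^sub>m n + U * mat_diag n s) powr (- \<alpha>))"

definition permanental_process ::
  "'a measure \<Rightarrow> real \<Rightarrow> 't set \<Rightarrow> ('t \<Rightarrow> 'a \<Rightarrow> real) \<Rightarrow> ('t \<Rightarrow> 't \<Rightarrow> real) \<Rightarrow> bool" where
  "permanental_process M \<alpha> T X u \<longleftrightarrow>
     (\<forall>n\<ge>1. \<forall>t. (\<forall>i<n. t i \<in> T) \<longrightarrow>
        permanental_vector M \<alpha> n (\<lambda>i. X (t i)) (Matrix.mat n n (\<lambda>(i, j). u (t i) (t j))))"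

definition sigma_fun :: "('t \<Rightarrow> 't \<Rightarrow> real) \<Rightarrow> 't \<Rightarrow> 't \<Rightarrow> real" where
  "sigma_fun u s t = sqrt (u s s + u t t - 2 * sqrt (u s t * u t s))"

text \<open>
  For the kernel of a process on \<open>[0, 1]\<close> with continuous paths the diagonal of the kernel is
  continuous (by continuity of the one-dimensional Laplace transforms), hence bounded, so that
  the real-valued supremum is a genuine one.
\<close>

definition u_star :: "(real \<Rightarrow> real \<Rightarrow> real) \<Rightarrow> real \<Rightarrow> real" where
  "u_star u h = (SUP t\<in>{t \<in> {0..1}. t \<le> h}. u t t)"

definition regularly_varying_at_zero :: "(real \<Rightarrow> real) \<Rightarrow> real \<Rightarrow> bool" where
  "regularly_varying_at_zero \<phi> \<rho> \<longleftrightarrow>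
     (\<exists>\<delta>>0. (\<forall>x\<in>{0<..<\<delta>}. 0 < \<phi> x) \<and> \<phi> \<in> borel_measurable (restrict_space borel {0<..<\<delta>})) \<and>
     (\<forall>c>0. ((\<lambda>x. \<phi> (c * x) / \<phi> x) \<longlongrightarrow> c powr \<rho>) (at_right 0))"

end

theory Submission
  imports Defs "HOL-Complex_Analysis.Cauchy_Integral_Formula"
begin

text \<open>
  All three bounds are statements about the square root \<open>\<surd>X\<close> of the process, whose increments
  behave like Gaussian ones: for every \<open>r < 1\<close> there is a constant \<open>K\<close>, depending only on \<open>r\<close> and
  \<open>\<alpha>\<close>, such that \<open>P(|\<surd>X(s) - \<surd>X(t)| \<ge> z v) \<le> K exp(-r\<^sup>2 z\<^sup>2)\<close> whenever \<open>v \<ge> \<sigma>(s,t)\<close>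
  (\<open>permanental_increment_tail\<close>). For \<open>\<alpha> = 1/2\<close> one may think of \<open>X = G\<^sup>2/2\<close> with \<open>G\<close> Gaussian
  of nonnegative covariance \<open>u\<close>, where \<open>\<sigma>(s,t)\<close> is the standard deviation of \<open>G(s) - G(t)\<close>. For general \<open>\<alpha>\<close> there is no such
  representation, and only the Laplace transform of the pair is used, which with
  \<open>a = u(s,s)\<close>, \<open>b = u(t,t)\<close>, \<open>d = u(s,t) u(t,s)\<close> is \<open>(1 + ap + bq + (ab - d)pq)\<close> to the power
  \<open>-\<alpha>\<close>. The point is that \<open>(\<surd>x - \<surd>y)\<^sup>2\<close>, for \<open>x \<ge> y\<close>, is the supremum over \<open>0 < \<eta> < 1\<close> of the
  linear functions \<open>\<eta> x - \<eta>/(1 - \<eta>) y\<close>. Each of them has exponential moments, found by continuing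
  the Laplace transform analytically to negative arguments (\<open>laplace_continuation\<close>), so it obeys a
  Chernoff bound. Letting \<open>\<eta>\<close> run through a geometric sequence loses only a factor \<open>r\<close> in the
  exponent, and the exponential moment for \<open>\<eta>\<close> is at most of order
  \<open>(\<eta>\<^sup>2 a / v\<^sup>2)\<close> to the power \<open>-\<alpha>\<close> (\<open>exponent_determinant_lower_bound\<close>). This decay makes the
  union bound over all relevant \<open>\<eta>\<close> a geometric series, with a sum that does not depend on the
  kernel.

  Regular variation of \<open>\<phi>\<close> with a positive index makes \<open>\<phi>(2\<^sup>-\<^sup>n\<^sup>-\<^sup>k)\<close> decay geometrically in \<open>k\<close>, so
  in a chaining argument on \<open>[0, 2\<^sup>-\<^sup>n]\<close> the dyadic levels beyond a fixed \<open>m\<close> contribute at most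
  \<open>\<epsilon> \<phi>(2\<^sup>-\<^sup>n) (log n)\<^sup>1\<^sup>/\<^sup>2\<close> (\<open>dyadic_local_modulus\<close>). The remaining \<open>2\<^sup>m\<close> grid points are treated
  one by one: at each of them \<open>z = (1 + \<epsilon>) (log n)\<^sup>1\<^sup>/\<^sup>2\<close> produces probabilities of order
  \<open>n\<close> to the power \<open>-(1 + \<epsilon>)\<close>, and the Borel-Cantelli lemma gives the sharp constant. Hence
  \<open>|\<surd>X(t) - \<surd>X(0)| \<le> (1 + \<epsilon>) \<phi>(h) (log log 1/h)\<^sup>1\<^sup>/\<^sup>2\<close> for all \<open>t \<le> h\<close> and small \<open>h\<close>
  (\<open>sqrt_increment_loglog\<close>); multiplying by \<open>\<surd>X(t) + \<surd>X(0)\<close>, which tends to \<open>2 \<surd>X(0)\<close>, gives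
  the first claim.

  If \<open>u(0,0) = 0\<close> then \<open>X(0) = 0\<close>, and at the grid points the upper tail of the gamma law of
  \<open>X(g)\<close> replaces the increment bound: \<open>X(g) \<le> (1 + \<epsilon>)\<^sup>2 u(g,g) log n\<close>. Passing from the grid point
  \<open>g\<close> to a nearby \<open>t\<close> changes both \<open>\<surd>X\<close> and \<open>\<surd>u\<close> by a small multiple of \<open>\<phi>(h)\<close>, up to the iterated
  logarithm (\<open>sqrt_upper_envelope\<close>), and \<open>\<phi>(h)\<close> is at most a constant times \<open>\<surd>u(h,h)\<close> by
  assumption. Both remaining claims follow.
\<close>

section \<open>Exponential moments from Laplace transforms\<close>

text \<open>
  Zeros of a nontrivial power series are isolated, so agreement on one side of the origin suffices;
  for a Laplace transform only one side may be at hand.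
\<close>

lemma power_series_unique_right:
  fixes a b :: "nat \<Rightarrow> real"
  assumes r: "0 < r"
    and eq: "\<And>z. 0 < z \<Longrightarrow> z < r \<Longrightarrow> (\<lambda>n. a n * z ^ n) sums f z"
            "\<And>z. 0 < z \<Longrightarrow> z < r \<Longrightarrow> (\<lambda>n. b n * z ^ n) sums f z"
  shows "a = b"
proof (rule ccontr)
  assume "a \<noteq> b"
  then obtain m where m: "a m \<noteq> b m" by (meson ext)
  \<comment> \<open>The isolation lemma concerns coefficients of positive index of a series that vanishes at 0,
    so the difference of the two series is multiplied by the variable.\<close>
  define c where "c n = (case n of 0 \<Rightarrow> 0 | Suc k \<Rightarrow> a k - b k)" for n
  have sm: "summable (\<lambda>n. c n * x ^ n)" if xr: "norm x < r" for x :: real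
  proof -
    obtain z where z: "norm x < z" "z < r" using dense[OF xr] by auto
    have "0 < z" using z(1) norm_ge_zero[of x] by linarith
    have "summable (\<lambda>n. (a n - b n) * z ^ n)"
      using summable_diff[OF sums_summable[OF eq(1)] sums_summable[OF eq(2)]] \<open>0 < z\<close> z
      by (simp add: algebra_simps)
    then have "summable (\<lambda>n. (a n - b n) * x ^ n)"
      by (rule powser_inside) (use z in auto)
    then have "summable (\<lambda>n. (a n - b n) * x ^ n * x)"
      by (rule summable_mult2)
    then have "summable (\<lambda>n. c (Suc n) * x ^ Suc n)"
      by (simp add: c_def mult_ac)
    then show ?thesis by (subst (asm) summable_Suc_iff)
  qed
  have zero: "(\<Sum>n. c n * z ^ n) = 0" if "0 < z" "z < r" for z
  proof -
    have "(\<lambda>n. c (Suc n) * z ^ Suc n) sums 0"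
      using sums_mult2[OF sums_diff[OF eq(1)[OF that] eq(2)[OF that]], of z]
      by (simp add: c_def algebra_simps)
    then have "(\<lambda>n. c n * z ^ n) sums 0"
      by (subst (asm) sums_Suc_iff) (simp add: c_def)
    then show ?thesis by (simp add: sums_iff)
  qed
  obtain s where s: "0 < s" "\<And>z. z \<in> cball 0 s - {0} \<Longrightarrow> (\<Sum>n. c n * z ^ n) \<noteq> 0"
    by (rule powser_0_nonzero[of r 0 c "\<lambda>x. \<Sum>n. c n * x ^ n" "Suc m"])
       (use r sm m in \<open>auto simp: c_def summable_sums\<close>)
  define z where "z = min s (r/2)"
  have "0 < z" "z < r" "z \<le> s" using r s(1) by (auto simp: z_def)
  then show False using zero[of z] s(2)[of z] by auto
qed

text \<open>
  A Laplace transform of the form \<open>(B + A s)\<close> to the power \<open>-\<alpha>\<close> is known for positive \<open>s\<close>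
  only. Expand it about \<open>s = 1\<close> in powers of \<open>z = 1 - s\<close>: all coefficients are moments of the
  nonnegative variable \<open>X\<close>, hence nonnegative, so by monotone convergence the expansion remains an
  identity as long as the binomial series converges, which is beyond \<open>z = 1\<close> and up to the
  singularity. The weight \<open>W\<close> will be the exponential factor of a second variable.
\<close>

lemma laplace_continuation:
  fixes X W :: "'a \<Rightarrow> real"
  assumes [measurable]: "X \<in> borel_measurable M" "W \<in> borel_measurable M"
    and nn: "\<And>\<omega>. \<omega> \<in> space M \<Longrightarrow> 0 \<le> X \<omega>" "\<And>\<omega>. \<omega> \<in> space M \<Longrightarrow> 0 \<le> W \<omega>"
    and A: "0 \<le> A" and B: "0 < B"
    and lt: "\<And>s. 0 < s \<Longrightarrow> (\<integral>\<omega>. exp (- s * X \<omega>) * W \<omega> \<partial>M) = (B + A * s) powr (- \<alpha>)"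
    and \<mu>: "0 \<le> \<mu>" "\<mu> * A < B"
  shows "(\<integral>\<^sup>+\<omega>. ennreal (exp (\<mu> * X \<omega>) * W \<omega>) \<partial>M) = ennreal ((B - \<mu> * A) powr (- \<alpha>))"
proof -
  define F where "F z = (\<integral>\<^sup>+\<omega>. ennreal (exp ((z - 1) * X \<omega>) * W \<omega>) \<partial>M)" for z
  define m where "m k = (\<integral>\<^sup>+\<omega>. ennreal (X \<omega> ^ k * exp (- X \<omega>) * W \<omega> / fact k) \<partial>M)" for k
  have series: "F z = (\<Sum>k. ennreal (z ^ k) * m k)" if z: "0 \<le> z" for z
  proof -
    have "ennreal (exp ((z - 1) * X \<omega>) * W \<omega>)
        = (\<Sum>k. ennreal (z ^ k) * ennreal (X \<omega> ^ k * exp (- X \<omega>) * W \<omega> / fact k))"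
      if "\<omega> \<in> space M" for \<omega>
    proof -
      have "(\<lambda>k. (z * X \<omega>) ^ k /\<^sub>R fact k * (exp (- X \<omega>) * W \<omega>)) sums
          (exp (z * X \<omega>) * (exp (- X \<omega>) * W \<omega>))"
        by (intro sums_mult2 exp_converges)
      then have "(\<lambda>k. z ^ k * (X \<omega> ^ k * exp (- X \<omega>) * W \<omega> / fact k)) sums
          (exp ((z - 1) * X \<omega>) * W \<omega>)"
        by (simp add: power_mult_distrib field_simps flip: exp_add)
      then have "(\<Sum>k. ennreal (z ^ k * (X \<omega> ^ k * exp (- X \<omega>) * W \<omega> / fact k))) =
          ennreal (exp ((z - 1) * X \<omega>) * W \<omega>)"
        using nn[OF that] z by (intro suminf_ennreal_eq) auto
      moreover have "ennreal (z ^ k * (X \<omega> ^ k * exp (- X \<omega>) * W \<omega> / fact k)) =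
          ennreal (z ^ k) * ennreal (X \<omega> ^ k * exp (- X \<omega>) * W \<omega> / fact k)" for k
        using z nn[OF that] by (intro ennreal_mult) auto
      ultimately show ?thesis by simp
    qed
    then have "F z = (\<integral>\<^sup>+\<omega>. (\<Sum>k. ennreal (z ^ k) * ennreal (X \<omega> ^ k * exp (- X \<omega>) * W \<omega> / fact k)) \<partial>M)"
      unfolding F_def by (intro nn_integral_cong) auto
    also have "\<dots> = (\<Sum>k. ennreal (z ^ k) * m k)"
      unfolding m_def by (subst nn_integral_suminf) (auto simp: nn_integral_cmult)
    finally show ?thesis .
  qed
  have small: "F z = ennreal ((B + A - A * z) powr (- \<alpha>))" if "0 < z" "z < 1" for z
  proof -
    have pos: "0 < B + A * (1 - z)" using A B that by (intro add_pos_nonneg) auto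
    have eq: "(\<integral>\<omega>. exp ((z - 1) * X \<omega>) * W \<omega> \<partial>M) = (B + A * (1 - z)) powr (- \<alpha>)"
      using lt[of "1 - z"] that by simp
    then have "integrable M (\<lambda>\<omega>. exp ((z - 1) * X \<omega>) * W \<omega>)"
      using pos not_integrable_integral_eq by fastforce
    then have "F z = ennreal (\<integral>\<omega>. exp ((z - 1) * X \<omega>) * W \<omega> \<partial>M)"
      unfolding F_def by (intro nn_integral_eq_integral) (auto simp: nn)
    then show ?thesis using eq by (simp add: algebra_simps)
  qed
  \<comment> \<open>The binomial series about \<open>s = 1\<close>; its radius of convergence \<open>1/\<zeta>\<close> exceeds 1.\<close>
  define \<zeta> where "\<zeta> = A / (B + A)"
  have BA: "0 < B + A" using A B by simp
  have \<zeta>: "0 \<le> \<zeta>" "\<zeta> < 1" using A B by (auto simp: \<zeta>_def)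
  define g where "g k = (B + A) powr (- \<alpha>) * ((- \<alpha>) gchoose k) * (- \<zeta>) ^ k" for k
  have binom: "(\<lambda>k. g k * z ^ k) sums ((B + A - A * z) powr (- \<alpha>))" if "0 \<le> z" "\<zeta> * z < 1" for z
  proof -
    have "(\<lambda>k. ((- \<alpha>) gchoose k) * (- (\<zeta> * z)) ^ k) sums ((1 + - (\<zeta> * z)) powr (- \<alpha>))"
      using that \<zeta> by (intro gen_binomial_real) (auto simp: abs_mult)
    then have "(\<lambda>k. (B + A) powr (- \<alpha>) * (((- \<alpha>) gchoose k) * (- (\<zeta> * z)) ^ k)) sums
       ((B + A) powr (- \<alpha>) * (1 + - (\<zeta> * z)) powr (- \<alpha>))" by (rule sums_mult)
    also have "(B + A) powr (- \<alpha>) * (1 + - (\<zeta> * z)) powr (- \<alpha>) = ((B + A) * (1 + - (\<zeta> * z))) powr (- \<alpha>)"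
      using BA that by (simp add: powr_mult)
    also have "(B + A) * (1 + - (\<zeta> * z)) = B + A - A * z"
      using BA by (simp add: \<zeta>_def field_simps)
    finally show ?thesis
      unfolding g_def by (simp only: mult.assoc mult_minus_left[symmetric] power_mult_distrib)
  qed
  have fin: "m k < \<infinity>" for k
  proof -
    have "ennreal ((1/2) ^ k) * m k \<le> (\<Sum>k. ennreal ((1/2) ^ k) * m k)"
      using sum_le_suminf[of "\<lambda>k. ennreal ((1/2) ^ k) * m k" "{k}"] by auto
    also have "\<dots> = F (1/2)" by (rule series[symmetric]) simp
    also have "\<dots> < \<infinity>" by (subst small) auto
    finally show ?thesis by (auto simp: ennreal_mult_less_top)
  qed
  define c where "c k = enn2real (m k)" for k
  have c: "m k = ennreal (c k)" "0 \<le> c k" for k using fin[of k] by (auto simp: c_def)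
  have Fc: "F z = (\<Sum>k. ennreal (c k * z ^ k))" if "0 \<le> z" for z
    using series[OF that] that c by (simp add: ennreal_mult mult.commute)
  have csums: "(\<lambda>k. c k * z ^ k) sums ((B + A - A * z) powr (- \<alpha>))" if "0 < z" "z < 1" for z
  proof -
    have *: "(\<Sum>k. ennreal (c k * z ^ k)) = ennreal ((B + A - A * z) powr (- \<alpha>))"
      using Fc[of z] small[OF that] that by simp
    then have "summable (\<lambda>k. c k * z ^ k)"
      using c that by (intro summable_suminf_not_top) auto
    then show ?thesis using * c that
      by (subst (asm) suminf_ennreal2) (auto simp: sums_iff suminf_nonneg)
  qed
  have "c = g"
  proof (rule power_series_unique_right[where r = 1, OF _ csums])
    fix z :: real assume z: "0 < z" "z < 1"
    have "\<zeta> * z < 1" using mult_strict_mono'[of \<zeta> 1 z 1] \<zeta> z by simp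
    then show "(\<lambda>k. g k * z ^ k) sums ((B + A - A * z) powr (- \<alpha>))" using z by (intro binom) auto
  qed auto
  moreover have "\<zeta> * (1 + \<mu>) < 1" using \<mu> BA by (simp add: \<zeta>_def field_simps)
  ultimately have "(\<lambda>k. c k * (1 + \<mu>) ^ k) sums ((B - \<mu> * A) powr (- \<alpha>))"
    using binom[of "1 + \<mu>"] \<mu> by (simp add: algebra_simps)
  then have "(\<Sum>k. ennreal (c k * (1 + \<mu>) ^ k)) = ennreal ((B - \<mu> * A) powr (- \<alpha>))"
    using \<mu> c by (intro suminf_ennreal_eq) auto
  then have "F (1 + \<mu>) = ennreal ((B - \<mu> * A) powr (- \<alpha>))"
    using Fc[of "1 + \<mu>"] \<mu> by simp
  then show ?thesis by (simp add: F_def)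
qed

lemma (in prob_space) chernoff_bound:
  fixes f :: "'a \<Rightarrow> real"
  assumes [measurable]: "f \<in> borel_measurable M"
    and K: "(\<integral>\<^sup>+\<omega>. ennreal (exp (f \<omega>)) \<partial>M) \<le> ennreal K" "0 \<le> K"
  shows "prob {\<omega> \<in> space M. c \<le> f \<omega>} \<le> K * exp (- c)"
proof -
  have "emeasure M {\<omega> \<in> space M. c \<le> f \<omega>}
      \<le> ennreal (exp (- 1 * c)) * (\<integral>\<^sup>+\<omega>. ennreal (exp (1 * f \<omega>)) * indicator (space M) \<omega> \<partial>M)"
    by (rule Chernoff_ineq_nn_integral_ge) auto
  then have "emeasure M {\<omega> \<in> space M. c \<le> f \<omega>}
      \<le> ennreal (exp (- c)) * (\<integral>\<^sup>+\<omega>. ennreal (exp (f \<omega>)) * indicator (space M) \<omega> \<partial>M)"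
    by simp
  also have "(\<integral>\<^sup>+\<omega>. ennreal (exp (f \<omega>)) * indicator (space M) \<omega> \<partial>M) = (\<integral>\<^sup>+\<omega>. ennreal (exp (f \<omega>)) \<partial>M)"
    by (intro nn_integral_cong) auto
  also have "ennreal (exp (- c)) * \<dots> \<le> ennreal (exp (- c)) * ennreal K"
    using K by (intro mult_left_mono) auto
  also have "\<dots> = ennreal (K * exp (- c))"
    using K(2) by (simp add: ennreal_mult mult.commute)
  finally show ?thesis using K(2) by (simp add: emeasure_eq_measure)
qed

section \<open>Sub-Gaussian increments of the square root of a permanental pair\<close>

text \<open>
  The one-dimensional transforms are listed separately because the permanental formula speaks
  of strictly positive arguments only. The kernel enters through its diagonal \<open>a\<close>, \<open>b\<close> and the
  product \<open>d\<close> of its off-diagonal entries; \<open>d\<close> may have either sign here.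
\<close>

definition bivariate_permanental ::
  "'a measure \<Rightarrow> real \<Rightarrow> ('a \<Rightarrow> real) \<Rightarrow> ('a \<Rightarrow> real) \<Rightarrow> real \<Rightarrow> real \<Rightarrow> real \<Rightarrow> bool" where
  "bivariate_permanental M \<alpha> X Y a b d \<longleftrightarrow>
     X \<in> borel_measurable M \<and> Y \<in> borel_measurable M \<and>
     (\<forall>\<omega>\<in>space M. 0 \<le> X \<omega> \<and> 0 \<le> Y \<omega>) \<and> 0 \<le> a \<and> 0 \<le> b \<and> d \<le> a * b \<and>
     (\<forall>s>0. (\<integral>\<omega>. exp (- s * X \<omega>) \<partial>M) = (1 + a * s) powr (- \<alpha>)) \<and>
     (\<forall>s>0. (\<integral>\<omega>. exp (- s * Y \<omega>) \<partial>M) = (1 + b * s) powr (- \<alpha>)) \<and>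
     (\<forall>s>0. \<forall>t>0. (\<integral>\<omega>. exp (- s * X \<omega>) * exp (- t * Y \<omega>) \<partial>M)
        = (1 + a * s + b * t + (a * b - d) * s * t) powr (- \<alpha>))"

lemma bivariate_permanental_commute:
  assumes "bivariate_permanental M \<alpha> X Y a b d"
  shows "bivariate_permanental M \<alpha> Y X b a d"
proof -
  have "(\<integral>\<omega>. exp (- s * Y \<omega>) * exp (- t * X \<omega>) \<partial>M)
      = (1 + b * s + a * t + (b * a - d) * s * t) powr (- \<alpha>)" if "0 < s" "0 < t" for s t
  proof -
    have "(\<integral>\<omega>. exp (- t * X \<omega>) * exp (- s * Y \<omega>) \<partial>M)
        = (1 + a * t + b * s + (a * b - d) * t * s) powr (- \<alpha>)"
      using assms that unfolding bivariate_permanental_def by blast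
    moreover have "1 + a * t + b * s + (a * b - d) * t * s = 1 + b * s + a * t + (b * a - d) * s * t"
      by (simp add: algebra_simps)
    ultimately show ?thesis by (simp add: ac_simps)
  qed
  then show ?thesis
    using assms unfolding bivariate_permanental_def by (auto simp: mult.commute)
qed

text \<open>
  The number \<open>w\<close> is allowed to exceed \<open>z\<^sup>2 a\<close> so that degenerate laws, \<open>a = 0\<close>, are covered: the
  Chernoff parameter is scaled by \<open>w\<close> and not by \<open>a\<close>.
\<close>

lemma (in prob_space) gamma_upper_tail:
  assumes [measurable]: "X \<in> borel_measurable M" and nn: "\<And>\<omega>. \<omega> \<in> space M \<Longrightarrow> 0 \<le> X \<omega>"
    and a: "0 \<le> a" and lt: "\<And>s. 0 < s \<Longrightarrow> (\<integral>\<omega>. exp (- s * X \<omega>) \<partial>M) = (1 + a * s) powr (- \<alpha>)"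
    and \<alpha>: "0 < \<alpha>" and \<theta>: "0 < \<theta>" "\<theta> < 1" and w: "0 < w" "z\<^sup>2 * a \<le> w"
  shows "prob {\<omega> \<in> space M. w \<le> X \<omega>} \<le> (1 - \<theta>) powr (- \<alpha>) * exp (- \<theta> * z\<^sup>2)"
proof -
  define \<mu> where "\<mu> = \<theta> * z\<^sup>2 / w"
  have \<mu>: "0 \<le> \<mu>" using \<theta> w by (simp add: \<mu>_def)
  have "\<mu> * a = \<theta> * (z\<^sup>2 * a / w)" by (simp add: \<mu>_def)
  also have "\<dots> \<le> \<theta> * 1" using \<theta> w by (intro mult_left_mono) auto
  finally have \<mu>a: "\<mu> * a \<le> \<theta>" by simp
  have "(\<integral>\<^sup>+\<omega>. ennreal (exp (\<mu> * X \<omega>) * 1) \<partial>M) = ennreal ((1 - \<mu> * a) powr (- \<alpha>))"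
    by (rule laplace_continuation) (use nn a lt \<mu> \<mu>a \<theta> in auto)
  also have "(1 - \<mu> * a) powr (- \<alpha>) \<le> (1 - \<theta>) powr (- \<alpha>)"
    using \<mu>a \<theta> \<alpha> by (intro powr_mono2') auto
  finally have "prob {\<omega> \<in> space M. \<theta> * z\<^sup>2 \<le> \<mu> * X \<omega>} \<le> (1 - \<theta>) powr (- \<alpha>) * exp (- (\<theta> * z\<^sup>2))"
    by (intro chernoff_bound) (auto simp: ennreal_leI)
  moreover have "prob {\<omega> \<in> space M. w \<le> X \<omega>} \<le> prob {\<omega> \<in> space M. \<theta> * z\<^sup>2 \<le> \<mu> * X \<omega>}"
  proof (intro finite_measure_mono)
    have "\<theta> * z\<^sup>2 = \<mu> * w" using w by (simp add: \<mu>_def)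
    then show "{\<omega> \<in> space M. w \<le> X \<omega>} \<subseteq> {\<omega> \<in> space M. \<theta> * z\<^sup>2 \<le> \<mu> * X \<omega>}"
      using \<mu> by (auto intro!: mult_left_mono)
  qed auto
  ultimately show ?thesis by simp
qed

text \<open>
  The right-hand side is the determinant of \<open>I - U D\<close>, where \<open>U\<close> is a symmetric kernel with diagonal
  \<open>A\<close>, \<open>B\<close> and off-diagonal entry \<open>C\<close>, and \<open>D\<close> is diagonal with the entries \<open>\<eta>\<close> and
  \<open>-\<eta>/(1 - \<eta>)\<close>; it governs the exponential moment of \<open>\<eta> x - \<eta>/(1 - \<eta>) y\<close>. In terms of
  \<open>\<eta> A\<^sup>1\<^sup>/\<^sup>2\<close> it is, up to the factor \<open>1 - \<eta>\<close>, a quadratic polynomial that stays positive because the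
  squared sigma function is at most \<open>\<theta> < 1\<close>. Growth of order \<open>\<eta>\<^sup>2 A\<close>, and not mere positivity, is
  what later makes a union bound over many values of \<open>\<eta>\<close> summable.
\<close>

lemma exponent_determinant_lower_bound:
  fixes A B C \<eta> \<theta> r :: real
  assumes A: "0 < A" and C: "C\<^sup>2 \<le> A * B" "A + B - 2 * C \<le> \<theta>"
    and \<theta>: "0 < \<theta>" "\<theta> < 1" and \<eta>: "0 < \<eta>" "\<eta> \<le> r" and r: "r < 1"
  shows "(1 - \<theta>) ^ 3 * (1 - r) / 16 * (\<eta>\<^sup>2 * A)
    \<le> 1 - \<eta> * A + \<eta> / (1 - \<eta>) * B - \<eta>\<^sup>2 / (1 - \<eta>) * (A * B - C\<^sup>2)"
    (is "?c * _ \<le> ?D")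
proof -
  define s where "s = sqrt A"
  \<comment> \<open>The regression of the second variable on the first one: \<open>T\<close> is the residual variance, \<open>C/A\<close>
    the regression coefficient, and \<open>g\<^sup>2 + T\<close> is the square of the sigma function.\<close>
  define g where "g = s - C / s"
  define T where "T = B - C\<^sup>2 / A"
  define m where "m = 1 - T - g\<^sup>2"
  define k where "k = 1 - T"
  define y where "y = \<eta> * s"
  have s: "0 < s" "A = s\<^sup>2" using A by (auto simp: s_def)
  have T: "0 \<le> T" using C(1) A by (simp add: T_def field_simps)
  have gT: "g\<^sup>2 + T = A + B - 2 * C"
    using s(1) by (simp add: g_def T_def s(2) power2_diff power_divide)
  have m: "1 - \<theta> \<le> m" "m \<le> k" "k \<le> 1" "k = m + g\<^sup>2"
    using gT C(2) T by (auto simp: m_def k_def)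
  have k0: "0 < k" "1 - \<theta> \<le> k" using m \<theta> by linarith+
  have g1: "g\<^sup>2 \<le> 1" using gT T C(2) \<theta> by linarith
  have B': "B = T + C\<^sup>2 / A" by (simp add: T_def)
  have Cs: "C = s * (s - g)" using s by (simp add: g_def field_simps power2_eq_square)
  have p: "0 < 1 - \<eta>" using \<eta> r by auto
  have "(1 - \<eta>) * ?D = (1 - \<eta>) - \<eta> * (1 - \<eta>) * A + \<eta> * B - \<eta>\<^sup>2 * (A * B - C\<^sup>2)"
  proof -
    have "q * (1 - w + \<eta> / q * B - \<eta>\<^sup>2 / q * Z) = q - w * q + \<eta> * B - \<eta>\<^sup>2 * Z" if "q \<noteq> 0" for q w Z
      using that by (simp add: field_simps)
    from this[of "1 - \<eta>" "\<eta> * A" "A * B - C\<^sup>2"] p show ?thesis by (simp add: mult_ac)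
  qed
  also have "\<dots> = (1 - \<eta>) - \<eta> * (1 - \<eta>) * A + \<eta> * (T + (s - g)\<^sup>2) - \<eta>\<^sup>2 * (A * T)"
  proof -
    have AT: "A * B - C\<^sup>2 = A * T" using A by (simp add: B' field_simps)
    have BT: "B = T + (s - g)\<^sup>2" using s by (simp add: B' Cs power_mult_distrib)
    show ?thesis by (simp only: AT BT[symmetric])
  qed
  also have "\<dots> = 1 - \<eta> * m + k * y\<^sup>2 - 2 * g * y"
    unfolding s(2) y_def m_def k_def by (simp add: algebra_simps power2_eq_square)
  finally have D: "(1 - \<eta>) * ?D = 1 - \<eta> * m + k * y\<^sup>2 - 2 * g * y" .
  have "1 - \<eta> * m + k * y\<^sup>2 - 2 * g * y = k * (y - g / k)\<^sup>2 + m * (1 / k - \<eta>)"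
  proof -
    have "k * (y - g / k)\<^sup>2 = k * y\<^sup>2 - 2 * g * y + g\<^sup>2 / k"
      using k0(1) by (simp add: field_simps power2_eq_square)
    moreover have "g\<^sup>2 / k = 1 - m * (1 / k)" using k0(1) m(4) by (simp add: field_simps)
    ultimately show ?thesis by (simp add: algebra_simps)
  qed
  also have "\<dots> \<ge> 0 + m * (1 - \<eta>)"
  proof (intro add_mono mult_left_mono)
    have "1 \<le> 1 / k" using k0(1) m(3) by simp
    then show "1 - \<eta> \<le> 1 / k - \<eta>" by simp
  qed (use k0(1) m(1) \<theta> in auto)
  also have "0 + m * (1 - \<eta>) \<ge> (1 - \<theta>) * (1 - \<eta>)" using m p by simp
  finally have D1: "(1 - \<theta>) * (1 - \<eta>) \<le> (1 - \<eta>) * ?D" using D by simp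
  have y0: "0 < y" using \<eta> s by (simp add: y_def)
  have yA: "\<eta>\<^sup>2 * A = y\<^sup>2" by (simp add: y_def s(2) power_mult_distrib)
  show ?thesis
  \<comment> \<open>Below this threshold the minimum of the quadratic polynomial in \<open>y\<close> suffices; above it, half of
    the leading term absorbs the linear one.\<close>
  proof (cases "y \<le> 4 / (1 - \<theta>)")
    case True
    then have "(1 - \<theta>) * y \<le> 4" using \<theta> by (simp add: field_simps)
    then have "((1 - \<theta>) * y)\<^sup>2 \<le> 4\<^sup>2" using \<theta> y0 by (intro power_mono) auto
    then have le: "(1 - \<theta>) * (1 - r) / 16 * ((1 - \<theta>) * y)\<^sup>2 \<le> (1 - \<theta>) * (1 - r) / 16 * 4\<^sup>2"
      using \<theta> r by (intro mult_left_mono) auto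
    have "?c * y\<^sup>2 = (1 - \<theta>) * (1 - r) / 16 * ((1 - \<theta>) * y)\<^sup>2"
      by (simp add: power_mult_distrib power3_eq_cube power2_eq_square mult_ac)
    also note le
    also have "(1 - \<theta>) * (1 - r) / 16 * 4\<^sup>2 = (1 - \<theta>) * (1 - r)" by simp
    finally have "?c * y\<^sup>2 \<le> (1 - \<theta>) * (1 - r)" .
    also have "\<dots> \<le> (1 - \<theta>) * 1" using \<theta> r \<eta> by (intro mult_left_mono) auto
    also have "\<dots> \<le> ?D" using D1 p by (simp add: mult.commute)
    finally show ?thesis by (simp add: yA)
  next
    case False
    then have y4: "4 \<le> (1 - \<theta>) * y" using \<theta> by (simp add: field_simps)
    have "g \<le> 1" using g1 by (simp add: abs_square_le_1)
    have "?c * y\<^sup>2 \<le> (1 - \<theta>) / 2 * y\<^sup>2"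
    proof (intro mult_right_mono)
      have "(1 - \<theta>) ^ 2 * (1 - r) \<le> 1 * 1" using \<theta> r \<eta> by (intro mult_mono power_le_one) auto
      then have "(1 - \<theta>) * ((1 - \<theta>) ^ 2 * (1 - r)) \<le> (1 - \<theta>) * 8" using \<theta> by (intro mult_left_mono) auto
      moreover have "?c = (1 - \<theta>) * ((1 - \<theta>) ^ 2 * (1 - r)) / 16"
        by (simp add: power3_eq_cube power2_eq_square mult_ac)
      ultimately show "?c \<le> (1 - \<theta>) / 2" by linarith
    qed auto
    also have "\<dots> \<le> (1 - \<theta>) * y\<^sup>2 - 2 * y"
      using mult_right_mono[OF y4, of y] y0 by (simp add: power2_eq_square field_simps)
    also have "\<dots> \<le> k * y\<^sup>2 - 2 * g * y"
    proof -
      have "(1 - \<theta>) * y\<^sup>2 \<le> k * y\<^sup>2" using k0(2) by (intro mult_right_mono) auto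
      moreover have "g * y \<le> 1 * y" using \<open>g \<le> 1\<close> y0 by (intro mult_right_mono) auto
      ultimately show ?thesis by linarith
    qed
    also have "\<dots> \<le> 1 - \<eta> * m + k * y\<^sup>2 - 2 * g * y"
    proof -
      have "m \<le> 1" "0 \<le> m" "\<eta> \<le> 1" using m(1-3) \<theta> \<eta> r by linarith+
      then have "\<eta> * m \<le> 1 * 1" using \<eta> by (intro mult_mono) auto
      then show ?thesis by simp
    qed
    also have "\<dots> = (1 - \<eta>) * ?D" by (simp only: D)
    also have "\<dots> \<le> 1 * ?D"
    proof (intro mult_right_mono)
      have "0 < (1 - \<eta>) * ?D" using D1 \<theta> p by (smt (verit) mult_pos_pos)
      then show "0 \<le> ?D" using p by (simp add: zero_less_mult_iff)
    qed (use \<eta> in auto)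
    finally show ?thesis by (simp add: yA)
  qed
qed

text \<open>
  Here \<open>x\<close> and \<open>(1 - \<kappa>)\<^sup>2 x\<close> are two numbers whose square roots differ by \<open>\<kappa> \<surd>x\<close>. The linear
  function with parameter \<open>\<eta> = \<kappa>\<close> takes exactly the value \<open>\<kappa>\<^sup>2 x\<close> at this pair; a parameter that
  is too small by a factor of at least \<open>r\<close> loses no more than the factor \<open>r\<close>.
\<close>

lemma square_root_gap_linearised:
  fixes \<kappa> \<eta> r x :: real
  assumes "0 < \<kappa>" "\<kappa> \<le> 1" "r * \<kappa> \<le> \<eta>" "0 < \<eta>" "\<eta> \<le> \<kappa>" "\<eta> < 1" "0 \<le> x"
  shows "r * (\<kappa>\<^sup>2 * x) \<le> \<eta> * x - \<eta> / (1 - \<eta>) * ((1 - \<kappa>)\<^sup>2 * x)"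
proof -
  have "0 \<le> \<eta> * ((1 - \<kappa>) * (\<kappa> - \<eta>))" using assms by simp
  then have "\<eta> * \<kappa> * (1 - \<eta>) \<le> \<eta> * ((1 - \<eta>) - (1 - \<kappa>)\<^sup>2)"
    by (simp add: algebra_simps power2_eq_square)
  then have "\<eta> * \<kappa> \<le> \<eta> * ((1 - \<eta>) - (1 - \<kappa>)\<^sup>2) / (1 - \<eta>)"
    using assms by (simp add: pos_le_divide_eq)
  also have "\<dots> = \<eta> - \<eta> / (1 - \<eta>) * (1 - \<kappa>)\<^sup>2" using assms by (simp add: field_simps)
  finally have 1: "\<eta> * \<kappa> \<le> \<eta> - \<eta> / (1 - \<eta>) * (1 - \<kappa>)\<^sup>2" .
  have "r * \<kappa>\<^sup>2 \<le> \<eta> * \<kappa>"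
    using mult_right_mono[OF assms(3), of \<kappa>] assms(1) by (simp add: power2_eq_square mult_ac)
  with 1 have "r * \<kappa>\<^sup>2 \<le> \<eta> - \<eta> / (1 - \<eta>) * (1 - \<kappa>)\<^sup>2" by simp
  from mult_right_mono[OF this assms(7)] show ?thesis by (simp add: algebra_simps)
qed

text \<open>
  If \<open>a \<le> v\<^sup>2\<close>, the difference is dominated by \<open>\<surd>X\<close> alone and the gamma tail suffices.
  Otherwise either \<open>X \<ge> z\<^sup>2 a\<close>, which is again a gamma tail event, or the relative gap
  \<open>\<kappa> = 1 - \<surd>(Y/X)\<close> is larger than \<open>v/\<surd>a\<close>, and then one of the linear functions with
  \<open>\<eta> = r, r\<^sup>2, r\<^sup>3, \<dots>\<close>, of which only finitely many qualify, is large. Their number is not bounded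
  in terms of \<open>r\<close> and \<open>\<alpha>\<close>, but their probabilities decrease geometrically away from the smallest
  \<open>\<eta>\<close>.
\<close>

lemma (in prob_space) sqrt_increment_upper_tail:
  fixes X Y :: "'a \<Rightarrow> real" and \<alpha> r :: real
  defines "c \<equiv> (1 - r) ^ 4 / 16 * r ^ 3"
  assumes biv: "bivariate_permanental M \<alpha> X Y a b d"
    and \<alpha>: "0 < \<alpha>" and r: "0 < r" "r < 1" and v: "0 < v" "a + b - 2 * sqrt d \<le> v\<^sup>2" and z: "0 < z"
  shows "prob {\<omega> \<in> space M. v * z \<le> sqrt (X \<omega>) - sqrt (Y \<omega>)}
    \<le> ((1 - r) powr (- \<alpha>) + c powr (- \<alpha>) / (1 - r powr (2 * \<alpha>))) * exp (- r\<^sup>2 * z\<^sup>2)"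
proof -
  have [measurable]: "X \<in> borel_measurable M" "Y \<in> borel_measurable M"
    and nn: "\<And>\<omega>. \<omega> \<in> space M \<Longrightarrow> 0 \<le> X \<omega>" "\<And>\<omega>. \<omega> \<in> space M \<Longrightarrow> 0 \<le> Y \<omega>"
    and ab: "0 \<le> a" "0 \<le> b" "d \<le> a * b"
    and ltX: "\<And>s. 0 < s \<Longrightarrow> (\<integral>\<omega>. exp (- s * X \<omega>) \<partial>M) = (1 + a * s) powr (- \<alpha>)"
    and lt: "\<And>s t. 0 < s \<Longrightarrow> 0 < t \<Longrightarrow> (\<integral>\<omega>. exp (- s * X \<omega>) * exp (- t * Y \<omega>) \<partial>M)
        = (1 + a * s + b * t + (a * b - d) * s * t) powr (- \<alpha>)"
    using biv unfolding bivariate_permanental_def by blast+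
  define q where "q = r powr (2 * \<alpha>)"
  have q: "0 < q" "q < 1" using r \<alpha> by (auto simp: q_def powr01_less_one)
  have c0: "0 < c" using r by (simp add: c_def)
  have gamma: "prob {\<omega> \<in> space M. w \<le> X \<omega>} \<le> (1 - r) powr (- \<alpha>) * exp (- r\<^sup>2 * z\<^sup>2)"
    if w: "0 < w" "z\<^sup>2 * a \<le> w" for w
  proof -
    have "prob {\<omega> \<in> space M. w \<le> X \<omega>} \<le> (1 - r) powr (- \<alpha>) * exp (- r * z\<^sup>2)"
      using nn ab ltX \<alpha> r w by (intro gamma_upper_tail) auto
    also have "r\<^sup>2 * z\<^sup>2 \<le> r * z\<^sup>2"
      using r by (intro mult_right_mono) (auto simp: power2_eq_square mult_left_le)
    then have "(1 - r) powr (- \<alpha>) * exp (- r * z\<^sup>2) \<le> (1 - r) powr (- \<alpha>) * exp (- r\<^sup>2 * z\<^sup>2)"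
      by (intro mult_left_mono) auto
    finally show ?thesis .
  qed
  show ?thesis
  proof (cases "a \<le> v\<^sup>2")
    case True
    have "v * z \<le> sqrt (X \<omega>)" if "v * z \<le> sqrt (X \<omega>) - sqrt (Y \<omega>)" "\<omega> \<in> space M" for \<omega>
      using that nn(2)[of \<omega>] real_sqrt_ge_zero[of "Y \<omega>"] by linarith
    then have "(v * z)\<^sup>2 \<le> X \<omega>" if "v * z \<le> sqrt (X \<omega>) - sqrt (Y \<omega>)" "\<omega> \<in> space M" for \<omega>
      using that nn(1)[of \<omega>] v z by (simp add: real_le_rsqrt sqrt_ge_absD)
    then have "prob {\<omega> \<in> space M. v * z \<le> sqrt (X \<omega>) - sqrt (Y \<omega>)}
        \<le> prob {\<omega> \<in> space M. (v * z)\<^sup>2 \<le> X \<omega>}"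
      by (intro finite_measure_mono) auto
    also have "\<dots> \<le> (1 - r) powr (- \<alpha>) * exp (- r\<^sup>2 * z\<^sup>2)"
      using True v z by (intro gamma) (auto simp: power_mult_distrib mult.commute)
    also have "\<dots> \<le> ((1 - r) powr (- \<alpha>) + c powr (- \<alpha>) / (1 - q)) * exp (- r\<^sup>2 * z\<^sup>2)"
      using q by (intro mult_right_mono) auto
    finally show ?thesis unfolding q_def .
  next
    case False
    then have av: "v\<^sup>2 < a" by simp
    then have a0: "0 < a" by (meson le_less_trans zero_le_power2)
    have "0 < sqrt d" using av v ab by linarith
    then have d0: "0 < d" by simp
    \<comment> \<open>The exponent is scaled by \<open>\<mu>\<close> so that the scaled kernel satisfies the hypothesis of the
      determinant bound with \<open>\<theta> = r\<close>.\<close>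
    define \<mu> where "\<mu> = r / v\<^sup>2"
    have \<mu>: "0 < \<mu>" using r v by (simp add: \<mu>_def)
    define \<eta> where "\<eta> n = r ^ Suc n" for n
    have \<eta>: "0 < \<eta> n" "\<eta> n \<le> r" "\<eta> n < 1" for n
    proof -
      show "0 < \<eta> n" using r by (simp add: \<eta>_def)
      show "\<eta> n \<le> r" using r by (simp add: \<eta>_def mult_left_le power_le_one)
      then show "\<eta> n < 1" using r by simp
    qed
    define y where "y n = r ^ n * (sqrt a / v)" for n
    have y0: "0 < y n" for n using r v a0 by (simp add: y_def)
    define f where "f n \<omega> = \<mu> * \<eta> n * X \<omega> + - (\<mu> * (\<eta> n / (1 - \<eta> n))) * Y \<omega>" for n \<omega>
    define E where "E n = {\<omega> \<in> space M. r\<^sup>2 * z\<^sup>2 \<le> f n \<omega>}" for n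
    have [measurable]: "f n \<in> borel_measurable M" for n unfolding f_def by measurable
    have E_meas: "E n \<in> sets M" for n unfolding E_def by measurable
    have E: "prob (E n) \<le> (c * (y n)\<^sup>2) powr (- \<alpha>) * exp (- (r\<^sup>2 * z\<^sup>2))" for n
    proof -
      let ?e = "\<eta> n"
      define t where "t = \<mu> * (?e / (1 - ?e))"
      define D where "D = 1 - ?e * (\<mu> * a) + ?e / (1 - ?e) * (\<mu> * b)
          - ?e\<^sup>2 / (1 - ?e) * ((\<mu> * a) * (\<mu> * b) - (\<mu> * sqrt d)\<^sup>2)"
      have t: "0 < t" using \<mu> \<eta>[of n] by (simp add: t_def)
      have "(1 - r) ^ 3 * (1 - r) / 16 * (?e\<^sup>2 * (\<mu> * a)) \<le> D"
        unfolding D_def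
      proof (rule exponent_determinant_lower_bound)
        show "(\<mu> * sqrt d)\<^sup>2 \<le> (\<mu> * a) * (\<mu> * b)"
          using ab d0 \<mu> by (simp add: power_mult_distrib power2_eq_square)
        have "\<mu> * (a + b - 2 * sqrt d) \<le> \<mu> * v\<^sup>2" using v \<mu> by (intro mult_left_mono) auto
        also have "\<dots> = r" using v by (simp add: \<mu>_def)
        finally show "\<mu> * a + \<mu> * b - 2 * (\<mu> * sqrt d) \<le> r" by (simp add: algebra_simps)
      qed (use \<mu> a0 r \<eta>[of n] in auto)
      also have "?e\<^sup>2 * (\<mu> * a) = r ^ 3 * (y n)\<^sup>2"
        using v a0 by (simp add: y_def \<mu>_def \<eta>_def power_mult_distrib power_divide
            power2_eq_square[of r] power3_eq_cube)
      also have "(1 - r) ^ 3 * (1 - r) / 16 * (r ^ 3 * (y n)\<^sup>2) = c * (y n)\<^sup>2"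
        by (simp add: c_def eval_nat_numeral)
      finally have D: "c * (y n)\<^sup>2 \<le> D" .
      have cy: "0 < c * (y n)\<^sup>2" using c0 y0[of n] by simp
      have Deq: "D = (1 + b * t) - \<mu> * ?e * (a + (a * b - d) * t)"
      proof -
        have "?e\<^sup>2 / (1 - ?e) = ?e * (?e / (1 - ?e))" by (simp add: power2_eq_square)
        moreover have "(\<mu> * sqrt d)\<^sup>2 = \<mu> * \<mu> * d"
          using d0 by (simp add: power_mult_distrib power2_eq_square)
        moreover have "1 - e * (\<mu> * a) + w * (\<mu> * b) - e * w * ((\<mu> * a) * (\<mu> * b) - \<mu> * \<mu> * d)
            = 1 + b * (\<mu> * w) - \<mu> * e * (a + (a * b - d) * (\<mu> * w))" for e w
          by (simp add: algebra_simps)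
        ultimately show ?thesis unfolding D_def t_def by (simp only:)
      qed
      have "(\<integral>\<^sup>+\<omega>. ennreal (exp (f n \<omega>)) \<partial>M)
          = (\<integral>\<^sup>+\<omega>. ennreal (exp ((\<mu> * ?e) * X \<omega>) * exp (- t * Y \<omega>)) \<partial>M)"
        by (simp add: f_def t_def flip: exp_add)
      also have "\<dots> = ennreal ((1 + b * t - \<mu> * ?e * (a + (a * b - d) * t)) powr (- \<alpha>))"
      proof (rule laplace_continuation)
        show "(\<integral>\<omega>. exp (- s * X \<omega>) * exp (- t * Y \<omega>) \<partial>M)
            = (1 + b * t + (a + (a * b - d) * t) * s) powr (- \<alpha>)" if "0 < s" for s
          using lt[OF that t] by (simp add: algebra_simps)
        show "0 \<le> a + (a * b - d) * t" "0 < 1 + b * t" using ab t by (auto intro: add_pos_nonneg)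
        show "\<mu> * ?e * (a + (a * b - d) * t) < 1 + b * t" using D Deq cy by linarith
      qed (use nn \<mu> \<eta>[of n] in auto)
      also have "\<dots> \<le> ennreal ((c * (y n)\<^sup>2) powr (- \<alpha>))"
        unfolding Deq[symmetric] using D cy \<alpha> by (intro ennreal_leI powr_mono2') auto
      finally show ?thesis
        unfolding E_def by (intro chernoff_bound) auto
    qed
    \<comment> \<open>The indices \<open>n\<close> for which \<open>\<eta> = r\<^sup>n\<^sup>+\<^sup>1\<close> can occur as an approximation of a gap \<open>\<kappa> > v/\<surd>a\<close>.\<close>
    define J where "J = {n. 1 \<le> y n}"
    have fin: "finite J"
    proof -
      have "(\<lambda>n. r ^ n * (sqrt a / v)) \<longlonglongrightarrow> 0 * (sqrt a / v)"
        using r by (intro tendsto_mult LIMSEQ_realpow_zero tendsto_const) auto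
      then have "eventually (\<lambda>n. y n < 1) sequentially"
        unfolding y_def by (intro order_tendstoD) auto
      then obtain N where "\<And>n. N \<le> n \<Longrightarrow> y n < 1" by (auto simp: eventually_sequentially)
      then have "J \<subseteq> {..N}" by (auto simp: J_def) (meson le_cases not_le)
      then show ?thesis by (rule finite_subset) simp
    qed
    have y_sum: "(\<Sum>n\<in>J. (c * (y n)\<^sup>2) powr (- \<alpha>)) \<le> c powr (- \<alpha>) / (1 - q)"
    proof (cases "J = {}")
      case True
      then show ?thesis using q by simp
    next
      case False
      define N where "N = Max J"
      have N: "N \<in> J" "\<And>n. n \<in> J \<Longrightarrow> n \<le> N" using fin False by (auto simp: N_def)
      have term_le: "(c * (y n)\<^sup>2) powr (- \<alpha>) \<le> c powr (- \<alpha>) * q ^ (N - n)" if "n \<in> J" for n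
      proof -
        define k where "k = N - n"
        have "y N = r ^ k * y n" using N(2)[OF that] by (simp add: y_def k_def flip: power_add)
        then have "1 \<le> r ^ k * y n" using N(1) by (simp add: J_def)
        then have "1\<^sup>2 \<le> (r ^ k * y n)\<^sup>2" by (intro power_mono) auto
        then have "c \<le> r ^ (2 * k) * (c * (y n)\<^sup>2)"
          using c0 by (simp add: power_mult_distrib power_mult[symmetric] mult.commute mult.left_commute)
        then have "(r ^ (2 * k) * (c * (y n)\<^sup>2)) powr (- \<alpha>) \<le> c powr (- \<alpha>)"
          using c0 \<alpha> by (intro powr_mono2') auto
        moreover have "(r ^ (2 * k)) powr (- \<alpha>) = 1 / q ^ k"
          using r by (simp add: q_def powr_minus divide_simps powr_powr flip: powr_realpow)
            (simp add: powr_power mult_ac)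
        ultimately have "1 / q ^ k * (c * (y n)\<^sup>2) powr (- \<alpha>) \<le> c powr (- \<alpha>)"
          using r c0 by (simp only: powr_mult[of "r ^ (2 * k)" "c * (y n)\<^sup>2"])
        then show ?thesis using q by (simp add: divide_le_eq k_def)
      qed
      have "(\<Sum>n\<in>J. (c * (y n)\<^sup>2) powr (- \<alpha>)) \<le> (\<Sum>n\<in>J. c powr (- \<alpha>) * q ^ (N - n))"
        by (intro sum_mono term_le)
      also have "\<dots> \<le> (\<Sum>n\<in>{..N}. c powr (- \<alpha>) * q ^ (N - n))"
        using N q by (intro sum_mono2) auto
      also have "\<dots> = c powr (- \<alpha>) * (\<Sum>n\<in>{..N}. q ^ n)"
        unfolding sum_distrib_left by (rule sum.reindex_bij_witness[of _ "\<lambda>i. N - i" "\<lambda>i. N - i"]) auto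
      also have "(\<Sum>n\<in>{..N}. q ^ n) \<le> (\<Sum>n. q ^ n)"
        using q by (intro sum_le_suminf) auto
      also have "(\<Sum>n. q ^ n) = 1 / (1 - q)" using q by (intro suminf_geometric) auto
      finally show ?thesis by (simp add: mult_left_mono)
    qed
    have cover: "{\<omega> \<in> space M. v * z \<le> sqrt (X \<omega>) - sqrt (Y \<omega>)}
        \<subseteq> {\<omega> \<in> space M. z\<^sup>2 * a \<le> X \<omega>} \<union> (\<Union>n\<in>J. E n)"
    proof
      fix \<omega> assume "\<omega> \<in> {\<omega> \<in> space M. v * z \<le> sqrt (X \<omega>) - sqrt (Y \<omega>)}"
      then have \<omega>: "\<omega> \<in> space M" "v * z \<le> sqrt (X \<omega>) - sqrt (Y \<omega>)" by auto
      show "\<omega> \<in> {\<omega> \<in> space M. z\<^sup>2 * a \<le> X \<omega>} \<union> (\<Union>n\<in>J. E n)"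
      proof (cases "z\<^sup>2 * a \<le> X \<omega>")
        case False
        define x where "x = sqrt (X \<omega>)"
        define \<kappa> where "\<kappa> = 1 - sqrt (Y \<omega>) / x"
        have vz: "0 < v * z" using v z by simp
        have x0: "0 < x" using \<omega>(2) vz real_sqrt_ge_zero[OF nn(2)[OF \<omega>(1)]] unfolding x_def by linarith
        have X: "X \<omega> = x\<^sup>2" using nn(1)[OF \<omega>(1)] by (simp add: x_def)
        have ys: "sqrt (Y \<omega>) = (1 - \<kappa>) * x" using x0 by (simp add: \<kappa>_def)
        then have Y: "Y \<omega> = (1 - \<kappa>)\<^sup>2 * x\<^sup>2"
          using nn(2)[OF \<omega>(1)] by (metis power_mult_distrib real_sqrt_pow2)
        have \<kappa>x: "v * z \<le> \<kappa> * x" using \<omega>(2) ys by (simp add: x_def[symmetric] algebra_simps)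
        have "0 < \<kappa> * x" using \<kappa>x vz by linarith
        then have \<kappa>0: "0 < \<kappa>" using x0 by (simp add: zero_less_mult_iff)
        have \<kappa>1: "\<kappa> \<le> 1" using x0 nn(2)[OF \<omega>(1)] by (simp add: \<kappa>_def)
        have "x < z * sqrt a"
        proof -
          have "x\<^sup>2 < (z * sqrt a)\<^sup>2" using False X a0 by (simp add: power_mult_distrib)
          then show ?thesis using z a0 by (meson power2_less_imp_less less_eq_real_def mult_nonneg_nonneg real_sqrt_ge_zero)
        qed
        then have "v * z < \<kappa> * (z * sqrt a)" using \<kappa>x \<kappa>0 by (meson le_less_trans mult_strict_left_mono)
        then have \<kappa>a: "v < \<kappa> * sqrt a" using z by (simp add: mult.left_commute mult.commute)
        obtain n where n: "r ^ Suc n \<le> \<kappa>" "\<kappa> \<le> r ^ n"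
        proof -
          obtain n0 where "r ^ n0 < \<kappa>" using \<kappa>0 r real_arch_pow_inv by blast
          then have "r ^ Suc n0 \<le> \<kappa>" using r by (smt (verit) power_Suc mult_left_le_one_le zero_less_power)
          then have ex: "\<exists>n. r ^ Suc n \<le> \<kappa>" by blast
          define n where "n = (LEAST n. r ^ Suc n \<le> \<kappa>)"
          have 1: "r ^ Suc n \<le> \<kappa>" unfolding n_def using ex by (rule LeastI_ex)
          have 2: "\<kappa> \<le> r ^ n"
          proof (cases n)
            case (Suc m)
            then have "\<not> r ^ Suc m \<le> \<kappa>" unfolding n_def using not_less_Least lessI by metis
            then show ?thesis using Suc by simp
          qed (use \<kappa>1 in simp)
          from 1 2 show ?thesis by (rule that)
        qed
        have "\<kappa> * sqrt a \<le> r ^ n * sqrt a" using n(2) a0 by (intro mult_right_mono) auto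
        then have "v \<le> r ^ n * sqrt a" using \<kappa>a by linarith
        then have nJ: "n \<in> J" using v by (simp add: J_def y_def)
        have "r * (\<kappa>\<^sup>2 * x\<^sup>2) \<le> \<eta> n * x\<^sup>2 - \<eta> n / (1 - \<eta> n) * ((1 - \<kappa>)\<^sup>2 * x\<^sup>2)"
          using n \<kappa>0 \<kappa>1 \<eta>[of n] r by (intro square_root_gap_linearised) (auto simp: \<eta>_def)
        moreover have "r * (v * z)\<^sup>2 \<le> r * (\<kappa>\<^sup>2 * x\<^sup>2)"
        proof (intro mult_left_mono)
          show "(v * z)\<^sup>2 \<le> \<kappa>\<^sup>2 * x\<^sup>2"
            using power_mono[OF \<kappa>x, of 2] vz by (simp add: power_mult_distrib)
        qed (use r in simp)
        ultimately have "\<mu> * (r * (v * z)\<^sup>2)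
            \<le> \<mu> * (\<eta> n * X \<omega> - \<eta> n / (1 - \<eta> n) * Y \<omega>)"
          using \<mu> X Y by (intro mult_left_mono) auto
        also have "\<mu> * (r * (v * z)\<^sup>2) = r\<^sup>2 * z\<^sup>2"
          using v by (simp add: \<mu>_def power_mult_distrib power2_eq_square)
        finally have "\<omega> \<in> E n" using \<omega> by (simp add: E_def f_def algebra_simps)
        then show ?thesis using nJ by blast
      qed (use \<omega> in auto)
    qed
    have "prob {\<omega> \<in> space M. v * z \<le> sqrt (X \<omega>) - sqrt (Y \<omega>)}
        \<le> prob ({\<omega> \<in> space M. z\<^sup>2 * a \<le> X \<omega>} \<union> (\<Union>n\<in>J. E n))"
      using E_meas fin by (intro finite_measure_mono cover) (auto intro!: sets.Un sets.finite_UN)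
    also have "\<dots> \<le> prob {\<omega> \<in> space M. z\<^sup>2 * a \<le> X \<omega>} + prob (\<Union>n\<in>J. E n)"
      using E_meas fin by (intro measure_Un_le) (auto intro!: sets.finite_UN)
    also have "prob (\<Union>n\<in>J. E n) \<le> (\<Sum>n\<in>J. prob (E n))"
      using fin E_meas by (intro finite_measure_subadditive_finite) auto
    also have "\<dots> \<le> (\<Sum>n\<in>J. (c * (y n)\<^sup>2) powr (- \<alpha>) * exp (- (r\<^sup>2 * z\<^sup>2)))"
      by (intro sum_mono E)
    also have "\<dots> = (\<Sum>n\<in>J. (c * (y n)\<^sup>2) powr (- \<alpha>)) * exp (- (r\<^sup>2 * z\<^sup>2))"
      by (simp add: sum_distrib_right)
    also have "\<dots> \<le> (c powr (- \<alpha>) / (1 - q)) * exp (- (r\<^sup>2 * z\<^sup>2))"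
      by (intro mult_right_mono y_sum) auto
    also have "prob {\<omega> \<in> space M. z\<^sup>2 * a \<le> X \<omega>} \<le> (1 - r) powr (- \<alpha>) * exp (- r\<^sup>2 * z\<^sup>2)"
      using z a0 by (intro gamma) auto
    finally show ?thesis by (simp add: algebra_simps q_def)
  qed
qed

section \<open>One- and two-dimensional laws of a permanental process\<close>

lemma kernel_times_diag:
  "Matrix.mat n n (\<lambda>(i, j). u i j) * mat_diag n s = Matrix.mat n n (\<lambda>(i, j). u i j * (s j :: real))"
  by (subst mat_diag_mult_right[of _ n n]) (auto intro!: cong_mat)

lemma det_permanental_1:
  "Determinant.det (1\<^sub>m 1 + Matrix.mat 1 1 (\<lambda>(i, j). u i j) * mat_diag 1 s) = 1 + u 0 0 * (s 0 :: real)"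
  unfolding kernel_times_diag by (subst det_single) auto

lemma det_permanental_2:
  "Determinant.det (1\<^sub>m 2 + Matrix.mat 2 2 (\<lambda>(i, j). u i j) * mat_diag 2 s)
    = (1 + u 0 0 * s 0) * (1 + u 1 1 * s 1) - u 0 1 * s 1 * (u 1 0 * (s 0 :: real))"
proof -
  define A where "A = 1\<^sub>m 2 + Matrix.mat 2 2 (\<lambda>(i, j). u i j * s j)"
  have A: "A \<in> carrier_mat 2 2" by (simp add: A_def)
  have det1: "Determinant.det (mat_delete A 0 j) = mat_delete A 0 j $$ (0, 0)" for j
    using mat_delete_carrier[OF A, of 0 j] by (intro det_single) simp
  have cof: "cofactor A 0 0 = A $$ (1,1)" "cofactor A 0 1 = - A $$ (1,0)"
    unfolding cofactor_def det1 using A by (auto simp: mat_delete_def)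
  have "Determinant.det A = (\<Sum>j<2. A $$ (0, j) * cofactor A 0 j)"
    by (rule laplace_expansion_row[OF A]) simp
  also have "\<dots> = A $$ (0,0) * cofactor A 0 0 + A $$ (0,1) * cofactor A 0 1"
    by (simp add: numeral_2_eq_2)
  finally show ?thesis unfolding cof kernel_times_diag A_def[symmetric] by (simp add: A_def)
qed

lemma (in prob_space) laplace_transform_pos:
  fixes Z :: "'a \<Rightarrow> real"
  assumes [measurable]: "Z \<in> borel_measurable M" and nn: "\<And>\<omega>. \<omega> \<in> space M \<Longrightarrow> 0 \<le> Z \<omega>"
  shows "0 < (\<integral>\<omega>. exp (- Z \<omega>) \<partial>M)"
proof -
  have int: "integrable M (\<lambda>\<omega>. exp (- Z \<omega>))"
    by (intro integrable_const_bound[where B = 1] AE_I2) (use nn in auto)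
  then have "(\<integral>\<omega>. exp (- Z \<omega>) \<partial>M) \<noteq> 0"
    by (subst integral_nonneg_eq_0_iff_AE) auto
  moreover have "0 \<le> (\<integral>\<omega>. exp (- Z \<omega>) \<partial>M)" by simp
  ultimately show ?thesis by linarith
qed

lemma permanental_vector_laplace:
  assumes "permanental_vector M \<alpha> n X U" "\<And>i. i < n \<Longrightarrow> 0 < s i"
  shows "(\<integral>\<omega>. exp (- (\<Sum>i<n. s i * X i \<omega>)) \<partial>M) = Determinant.det (1\<^sub>m n + U * mat_diag n s) powr (- \<alpha>)"
  using assms unfolding permanental_vector_def by simp

text \<open>
  A negative diagonal entry would make the transform vanish at \<open>s = -1/u(t,t)\<close>, since
  \<open>0 powr (-\<alpha>) = 0\<close>, whereas an expectation of a positive variable is positive.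
\<close>

lemma (in prob_space) permanental_process_marginal:
  assumes "permanental_process M \<alpha> T X u" "t \<in> T"
  shows "X t \<in> borel_measurable M" "\<forall>\<omega>\<in>space M. 0 \<le> X t \<omega>" "0 \<le> u t t"
    "\<forall>s>0. (\<integral>\<omega>. exp (- s * X t \<omega>) \<partial>M) = (1 + u t t * s) powr (- \<alpha>)"
proof -
  have pv: "permanental_vector M \<alpha> 1 (\<lambda>i. X t) (Matrix.mat 1 1 (\<lambda>(i, j). u t t))"
    using assms unfolding permanental_process_def by (auto dest!: spec[of _ 1] spec[of _ "\<lambda>_. t"])
  show m: "X t \<in> borel_measurable M" and nn: "\<forall>\<omega>\<in>space M. 0 \<le> X t \<omega>"
    using pv unfolding permanental_vector_def by auto
  have lt: "(\<integral>\<omega>. exp (- s * X t \<omega>) \<partial>M) = (1 + u t t * s) powr (- \<alpha>)" if "0 < s" for s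
    using permanental_vector_laplace[OF pv, of "\<lambda>_. s"] that
    unfolding det_permanental_1[of "\<lambda>i j. u t t" "\<lambda>_. s"] by simp
  then show "\<forall>s>0. (\<integral>\<omega>. exp (- s * X t \<omega>) \<partial>M) = (1 + u t t * s) powr (- \<alpha>)" by blast
  show "0 \<le> u t t"
  proof (rule ccontr)
    assume neg: "\<not> 0 \<le> u t t"
    have "(\<integral>\<omega>. exp (- ((- 1 / u t t) * X t \<omega>)) \<partial>M) = 0"
      using lt[of "- 1 / u t t"] neg by (simp add: divide_less_0_iff)
    moreover have "0 < (\<integral>\<omega>. exp (- ((- 1 / u t t) * X t \<omega>)) \<partial>M)"
      using m nn neg by (intro laplace_transform_pos) (auto simp: divide_le_0_iff)
    ultimately show False by simp
  qed
qed

text \<open>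
  The inequality \<open>d \<le> a b\<close> holds because otherwise the quadratic polynomial
  \<open>1 + (a + b) x + (a b - d) x\<^sup>2\<close> would have a positive root, at which the expectation of a positive
  variable would vanish.
\<close>

lemma (in prob_space) permanental_process_bivariate:
  assumes pp: "permanental_process M \<alpha> T X u" and st: "s \<in> T" "t \<in> T"
  shows "bivariate_permanental M \<alpha> (X s) (X t) (u s s) (u t t) (u s t * u t s)"
proof -
  note ms = permanental_process_marginal[OF pp st(1)]
  note mt = permanental_process_marginal[OF pp st(2)]
  have [measurable]: "X s \<in> borel_measurable M" "X t \<in> borel_measurable M" using ms mt by auto
  let ?d = "u s s * u t t - u s t * u t s"
  define \<tau> where "\<tau> i = (if i = 0 then s else t)" for i :: nat
  have pv: "permanental_vector M \<alpha> 2 (\<lambda>i. X (\<tau> i)) (Matrix.mat 2 2 (\<lambda>(i, j). u (\<tau> i) (\<tau> j)))"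
  proof -
    have "(1::nat) \<le> 2" "\<forall>i<2. \<tau> i \<in> T" using st by (auto simp: \<tau>_def)
    then show ?thesis using pp unfolding permanental_process_def by blast
  qed
  have lt: "(\<integral>\<omega>. exp (- p * X s \<omega>) * exp (- q * X t \<omega>) \<partial>M)
      = (1 + u s s * p + u t t * q + ?d * p * q) powr (- \<alpha>)" if "0 < p" "0 < q" for p q
  proof -
    define \<pi> where "\<pi> i = (if i = 0 then p else q)" for i :: nat
    have "(\<integral>\<omega>. exp (- (\<Sum>i<2. \<pi> i * X (\<tau> i) \<omega>)) \<partial>M)
        = Determinant.det (1\<^sub>m 2 + Matrix.mat 2 2 (\<lambda>(i, j). u (\<tau> i) (\<tau> j)) * mat_diag 2 \<pi>) powr (- \<alpha>)"
      by (rule permanental_vector_laplace[OF pv]) (use that in \<open>simp add: \<pi>_def\<close>)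
    also have "Determinant.det (1\<^sub>m 2 + Matrix.mat 2 2 (\<lambda>(i, j). u (\<tau> i) (\<tau> j)) * mat_diag 2 \<pi>)
        = 1 + u s s * p + u t t * q + ?d * p * q"
      unfolding det_permanental_2[of "\<lambda>i j. u (\<tau> i) (\<tau> j)" \<pi>] by (simp add: \<tau>_def \<pi>_def algebra_simps)
    finally have *: "(\<integral>\<omega>. exp (- (\<Sum>i<2. \<pi> i * X (\<tau> i) \<omega>)) \<partial>M)
        = (1 + u s s * p + u t t * q + ?d * p * q) powr (- \<alpha>)" .
    have "(\<Sum>i<2. \<pi> i * X (\<tau> i) \<omega>) = p * X s \<omega> + q * X t \<omega>" for \<omega>
      by (simp add: numeral_2_eq_2 \<tau>_def \<pi>_def)
    then have "exp (- p * X s \<omega>) * exp (- q * X t \<omega>) = exp (- (\<Sum>i<2. \<pi> i * X (\<tau> i) \<omega>))" for \<omega>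
      by (simp add: exp_add[symmetric])
    with * show ?thesis by (simp only:)
  qed
  have "0 \<le> ?d"
  proof (rule ccontr)
    assume neg: "\<not> 0 \<le> ?d"
    define P where "P x = 1 + u s s * x + u t t * x + ?d * x * x" for x
    have pos: "P x \<noteq> 0" if "0 < x" for x
    proof
      assume "P x = 0"
      then have "(\<integral>\<omega>. exp (- (x * X s \<omega> + x * X t \<omega>)) \<partial>M) = 0"
        using lt[OF that that] by (simp add: P_def exp_add[symmetric])
      moreover have "0 < (\<integral>\<omega>. exp (- (x * X s \<omega> + x * X t \<omega>)) \<partial>M)"
        using ms mt that by (intro laplace_transform_pos) auto
      ultimately show False by simp
    qed
    define c e where "c = u s s + u t t" and "e = - ?d"
    \<comment> \<open>A point beyond the positive root of the quadratic polynomial.\<close>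
    define y where "y = (c + 1) / e + 1"
    have c: "0 \<le> c" "0 < e" using ms mt neg by (auto simp: c_def e_def)
    then have y: "1 \<le> y" by (simp add: y_def)
    have "c + 1 \<le> e * y" using c by (simp add: y_def field_simps)
    then have "(c + 1) * y \<le> e * y * y" using y by (intro mult_right_mono) auto
    moreover have "P y = 1 + c * y - e * y * y" by (simp add: P_def c_def e_def algebra_simps)
    ultimately have "P y \<le> 0" using y by (simp add: distrib_right)
    moreover have "continuous_on {0..y} P" unfolding P_def by (intro continuous_intros)
    moreover have "0 \<le> P 0" by (simp add: P_def)
    ultimately obtain x where x: "0 \<le> x" "x \<le> y" "P x = 0"
      using IVT2'[of P y 0 0] y by auto
    then have "x \<noteq> 0" by (auto simp: P_def)
    then show False using pos[of x] x by simp
  qed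
  then show ?thesis
    unfolding bivariate_permanental_def using ms mt lt by auto
qed

text \<open>
  The radicand in the sigma function is nonnegative as soon as \<open>d \<le> a b\<close>; for negative \<open>d\<close> the
  real square root is odd, which only enlarges the radicand.
\<close>

lemma sigma_fun_square:
  assumes "0 \<le> u s s" "0 \<le> u t t" "u s t * u t s \<le> u s s * u t t"
  shows "(sqrt (u s s) - sqrt (u t t))\<^sup>2 \<le> (sigma_fun u s t)\<^sup>2"
    "u s s + u t t - 2 * sqrt (u s t * u t s) = (sigma_fun u s t)\<^sup>2" "0 \<le> sigma_fun u s t"
proof -
  have "sqrt (u s t * u t s) \<le> sqrt (u s s) * sqrt (u t t)"
    using assms(3) by (simp flip: real_sqrt_mult)
  then have le: "(sqrt (u s s) - sqrt (u t t))\<^sup>2 \<le> u s s + u t t - 2 * sqrt (u s t * u t s)"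
    using assms by (simp add: power2_diff)
  then have nn: "0 \<le> u s s + u t t - 2 * sqrt (u s t * u t s)"
    by (meson order_trans zero_le_power2)
  then show eq: "u s s + u t t - 2 * sqrt (u s t * u t s) = (sigma_fun u s t)\<^sup>2"
    and "0 \<le> sigma_fun u s t" by (auto simp: sigma_fun_def)
  show "(sqrt (u s s) - sqrt (u t t))\<^sup>2 \<le> (sigma_fun u s t)\<^sup>2"
    using le unfolding eq .
qed

text \<open>
  The bound is stated for any \<open>v\<close> above the sigma function, so that it also applies, with \<open>v > 0\<close>,
  to pairs at which the sigma function vanishes.
\<close>

lemma (in prob_space) permanental_increment_tail:
  assumes pp: "permanental_process M \<alpha> T X u" and \<alpha>: "0 < \<alpha>" and r: "0 < r" "r < 1"
  obtains K where "0 \<le> K" "\<And>s t v z. s \<in> T \<Longrightarrow> t \<in> T \<Longrightarrow> 0 < v \<Longrightarrow> sigma_fun u s t \<le> v \<Longrightarrow> 0 < z \<Longrightarrow>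
    prob {\<omega> \<in> space M. v * z \<le> \<bar>sqrt (X s \<omega>) - sqrt (X t \<omega>)\<bar>} \<le> K * exp (- r\<^sup>2 * z\<^sup>2)"
proof -
  define K where "K = (1 - r) powr (- \<alpha>)
      + ((1 - r) ^ 4 / 16 * r ^ 3) powr (- \<alpha>) / (1 - r powr (2 * \<alpha>))"
  have "prob {\<omega> \<in> space M. v * z \<le> \<bar>sqrt (X s \<omega>) - sqrt (X t \<omega>)\<bar>} \<le> 2 * K * exp (- r\<^sup>2 * z\<^sup>2)"
    if st: "s \<in> T" "t \<in> T" and v: "0 < v" "sigma_fun u s t \<le> v" and z: "0 < z" for s t v z
  proof -
    note biv = permanental_process_bivariate[OF pp st]
    have [measurable]: "X s \<in> borel_measurable M" "X t \<in> borel_measurable M"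
      and uu: "0 \<le> u s s" "0 \<le> u t t" "u s t * u t s \<le> u s s * u t t"
      using biv unfolding bivariate_permanental_def by auto
    note sig = sigma_fun_square[OF uu]
    have sv: "u s s + u t t - 2 * sqrt (u s t * u t s) \<le> v\<^sup>2"
      unfolding sig(2) using sig(3) v by (intro power_mono) auto
    have "prob {\<omega> \<in> space M. v * z \<le> sqrt (X s \<omega>) - sqrt (X t \<omega>)} \<le> K * exp (- r\<^sup>2 * z\<^sup>2)"
      unfolding K_def using sqrt_increment_upper_tail[OF biv \<alpha> r v(1) sv z] .
    moreover have "prob {\<omega> \<in> space M. v * z \<le> sqrt (X t \<omega>) - sqrt (X s \<omega>)} \<le> K * exp (- r\<^sup>2 * z\<^sup>2)"
      unfolding K_def
      by (rule sqrt_increment_upper_tail[OF bivariate_permanental_commute[OF biv] \<alpha> r v(1) _ z])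
         (use sv in simp)
    moreover have "prob {\<omega> \<in> space M. v * z \<le> \<bar>sqrt (X s \<omega>) - sqrt (X t \<omega>)\<bar>}
        \<le> prob ({\<omega> \<in> space M. v * z \<le> sqrt (X s \<omega>) - sqrt (X t \<omega>)}
          \<union> {\<omega> \<in> space M. v * z \<le> sqrt (X t \<omega>) - sqrt (X s \<omega>)})"
      by (intro finite_measure_mono) (auto simp: abs_if split: if_splits)
    moreover have "\<dots> \<le> prob {\<omega> \<in> space M. v * z \<le> sqrt (X s \<omega>) - sqrt (X t \<omega>)}
          + prob {\<omega> \<in> space M. v * z \<le> sqrt (X t \<omega>) - sqrt (X s \<omega>)}"
      by (intro measure_Un_le) auto
    ultimately show ?thesis by simp
  qed
  moreover have "0 \<le> 2 * K"
    using \<alpha> r powr01_less_one[of r "2 * \<alpha>"] by (simp add: K_def)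
  ultimately show thesis using that by blast
qed

section \<open>Dyadic grids, regular variation and iterated logarithms\<close>

definition grid :: "nat \<Rightarrow> real \<Rightarrow> real" where
  "grid k t = real (nat \<lfloor>2 ^ k * t\<rfloor>) / 2 ^ k"

lemma grid_bounds:
  assumes "0 \<le> t"
  shows "0 \<le> grid k t" "grid k t \<le> t" "t - grid k t \<le> (1/2) ^ k"
proof -
  have "0 \<le> \<lfloor>2 ^ k * t\<rfloor>" using assms by simp
  then have "real (nat \<lfloor>2 ^ k * t\<rfloor>) = of_int \<lfloor>2 ^ k * t\<rfloor>" by simp
  then have "real (nat \<lfloor>2 ^ k * t\<rfloor>) \<le> 2 ^ k * t" "2 ^ k * t \<le> real (nat \<lfloor>2 ^ k * t\<rfloor>) + 1"
    by linarith+
  then have "real (nat \<lfloor>2 ^ k * t\<rfloor>) / 2 ^ k \<le> t" "t \<le> (real (nat \<lfloor>2 ^ k * t\<rfloor>) + 1) / 2 ^ k"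
    by (simp_all only: pos_divide_le_eq pos_le_divide_eq zero_less_power zero_less_numeral mult.commute)
  then show "grid k t \<le> t" "t - grid k t \<le> (1/2) ^ k"
    unfolding grid_def by (auto simp only: add_divide_distrib power_one_over)
qed (simp add: grid_def)

lemma grid_point:
  assumes "0 \<le> t" "t \<le> (1/2) ^ n"
  obtains i where "i \<le> 2 ^ m" "grid (n + m) t = (1/2) ^ n * (real i / 2 ^ m)"
proof -
  define i where "i = nat \<lfloor>2 ^ (n + m) * t\<rfloor>"
  have "2 ^ (n + m) * t \<le> 2 ^ (n + m) * (1/2) ^ n" using assms by (intro mult_left_mono) auto
  also have "\<dots> = 2 ^ m" by (simp add: power_add power_one_over)
  finally have "\<lfloor>2 ^ (n + m) * t\<rfloor> \<le> \<lfloor>2 ^ m :: real\<rfloor>" by (rule floor_mono)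
  also have "\<lfloor>2 ^ m :: real\<rfloor> = 2 ^ m" by (metis floor_of_int of_int_numeral of_int_power)
  finally have "i \<le> 2 ^ m" unfolding i_def by (simp add: nat_le_iff)
  moreover have "grid (n + m) t = (1/2) ^ n * (real i / 2 ^ m)"
    by (simp add: grid_def i_def power_add power_one_over)
  ultimately show thesis by (rule that)
qed

lemma grid_01:
  assumes "i \<le> 2 ^ m"
  shows "(1/2) ^ n * (real i / 2 ^ m) \<in> {0..1}"
proof -
  have "real i \<le> 2 ^ m" using assms by (metis of_nat_le_iff of_nat_numeral of_nat_power)
  then have "(1/2::real) ^ n * (real i / 2 ^ m) \<le> 1 * 1"
    by (intro mult_mono power_le_one) auto
  then show ?thesis by simp
qed

text \<open>
  The grid points of \<open>t\<close> at consecutive levels coincide or are neighbours at the finer level, so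
  the increments telescope, and continuity allows passing to the limit.
\<close>

lemma dyadic_chaining:
  fixes f :: "real \<Rightarrow> real"
  assumes cont: "continuous_on {0..1} f"
    and inc: "\<And>k i. m < k \<Longrightarrow> i < 2 ^ k \<Longrightarrow> \<bar>f (real (Suc i) / 2 ^ k) - f (real i / 2 ^ k)\<bar> \<le> e k"
    and e: "summable (\<lambda>k. e (k + Suc m))" and t: "t \<in> {0..1}"
  shows "\<bar>f t - f (grid m t)\<bar> \<le> (\<Sum>k. e (k + Suc m))"
proof -
  have step: "\<bar>f (grid (Suc k) t) - f (grid k t)\<bar> \<le> e (Suc k)" if "m \<le> k" for k
  proof -
    define a b where "a = nat \<lfloor>2 ^ k * t\<rfloor>" and "b = nat \<lfloor>2 ^ Suc k * t\<rfloor>"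
    have "0 \<le> \<lfloor>2 ^ k * t\<rfloor>" "0 \<le> \<lfloor>2 ^ Suc k * t\<rfloor>" using t by simp_all
    then have "real a = of_int \<lfloor>2 ^ k * t\<rfloor>" "real b = of_int \<lfloor>2 ^ Suc k * t\<rfloor>"
      by (simp_all add: a_def b_def)
    then have ab: "real a \<le> 2 ^ k * t" "2 ^ k * t < real a + 1" "real b \<le> 2 * (2 ^ k * t)" "2 * (2 ^ k * t) < real b + 1"
      by (simp_all; linarith)+
    have "real b < 2 * real a + 2" "2 * real a < real b + 1" using ab by linarith+
    then have "b = 2 * a \<or> b = Suc (2 * a)" by linarith
    then show ?thesis
    proof
      assume "b = 2 * a"
      then have "grid (Suc k) t = grid k t" unfolding grid_def a_def[symmetric] b_def[symmetric] by simp
      moreover have "0 \<le> e (Suc k)" using inc[of "Suc k" 0] that by (intro order_trans[OF abs_ge_zero]) auto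
      ultimately show ?thesis by simp
    next
      assume b: "b = Suc (2 * a)"
      have "2 * (2 ^ k * t) \<le> 2 * (2 ^ k * 1)" using t by (intro mult_left_mono) auto
      then have "real (Suc (2 * a)) \<le> 2 * 2 ^ k" using ab(3) unfolding b by linarith
      then have "real (Suc (2 * a)) \<le> real (2 ^ Suc k)" by simp
      then have a2: "2 * a < 2 ^ Suc k" unfolding of_nat_le_iff by simp
      have "grid (Suc k) t = real (Suc (2 * a)) / 2 ^ Suc k" "grid k t = real (2 * a) / 2 ^ Suc k"
        unfolding grid_def a_def[symmetric] b_def[symmetric] using b by simp_all
      then show ?thesis using inc[OF _ a2] that by simp
    qed
  qed
  have nn: "0 \<le> e k" if "m < k" for k
    using inc[OF that, of 0] by (intro order_trans[OF abs_ge_zero]) auto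
  have "\<bar>f (grid (m + j) t) - f (grid m t)\<bar> \<le> (\<Sum>k<j. e (k + Suc m))" for j
  proof (induction j)
    case (Suc j)
    then show ?case using step[of "m + j"] by (simp add: add.commute)
  qed simp
  also have "(\<Sum>k<j. e (k + Suc m)) \<le> (\<Sum>k. e (k + Suc m))" for j
    using e nn by (intro sum_le_suminf) auto
  finally have bound: "\<bar>f (grid (m + j) t) - f (grid m t)\<bar> \<le> (\<Sum>k. e (k + Suc m))" for j .
  have "(\<lambda>k. grid k t) \<longlonglongrightarrow> t"
  proof (rule LIMSEQ_I)
    show "\<exists>no. \<forall>n\<ge>no. norm (grid n t - t) < \<epsilon>" if \<epsilon>: "0 < \<epsilon>" for \<epsilon> :: real
    proof -
      obtain N where N: "(1/2) ^ N < \<epsilon>" using real_arch_pow_inv[OF \<epsilon>, of "1/2"] by auto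
      have "norm (grid n t - t) < \<epsilon>" if "N \<le> n" for n
      proof -
        have "(1/2::real) ^ n \<le> (1/2) ^ N" using that by (intro power_decreasing) auto
        moreover have "0 \<le> t" using t by simp
        ultimately show ?thesis
          using grid_bounds(2,3)[of t n] N unfolding real_norm_def by linarith
      qed
      then show ?thesis by blast
    qed
  qed
  then have "(\<lambda>j. grid (j + m) t) \<longlonglongrightarrow> t" by (rule LIMSEQ_ignore_initial_segment)
  then have "(\<lambda>j. f (grid (j + m) t)) \<longlonglongrightarrow> f t"
    using t by (intro continuous_on_tendsto_compose[OF cont])
      (auto intro!: always_eventually order_trans[OF grid_bounds(2)] grid_bounds(1))
  then have "(\<lambda>j. \<bar>f (grid (j + m) t) - f (grid m t)\<bar>) \<longlonglongrightarrow> \<bar>f t - f (grid m t)\<bar>"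
    by (intro tendsto_intros)
  then show ?thesis
    by (rule LIMSEQ_le_const2) (use bound in \<open>auto simp: add.commute\<close>)
qed

text \<open>
  At scale factor one half the ratio tends to \<open>(1/2)\<close> to the power \<open>\<rho>\<close>, which lies strictly between
  0 and 1 because the index is positive.
\<close>

lemma regularly_varying_dyadic:
  assumes rv: "regularly_varying_at_zero \<phi> \<rho>" and \<rho>: "0 < \<rho>"
  obtains r C N where "0 < r" "r < 1" "0 < C"
    "\<And>n. N \<le> n \<Longrightarrow> \<phi> ((1/2) ^ Suc n) \<le> r * \<phi> ((1/2) ^ n)"
    "\<And>n. N \<le> n \<Longrightarrow> \<phi> ((1/2) ^ n) \<le> C * \<phi> ((1/2) ^ Suc n)"
proof -
  define q where "q = (1/2::real) powr \<rho>"
  have q: "0 < q" "q < 1" using \<rho> by (auto simp: q_def powr01_less_one)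
  obtain \<delta> where \<delta>: "0 < \<delta>" "\<And>x. 0 < x \<Longrightarrow> x < \<delta> \<Longrightarrow> 0 < \<phi> x"
    using rv unfolding regularly_varying_at_zero_def by auto
  have "\<forall>c>0. ((\<lambda>x. \<phi> (c * x) / \<phi> x) \<longlongrightarrow> c powr \<rho>) (at_right 0)"
    using rv unfolding regularly_varying_at_zero_def by blast
  then have "((\<lambda>x. \<phi> (1/2 * x) / \<phi> x) \<longlongrightarrow> q) (at_right 0)"
    unfolding q_def by (rule allE[of _ "1/2"]) simp
  moreover have half: "filterlim (\<lambda>n. (1/2::real) ^ n) (at_right 0) sequentially"
    unfolding filterlim_at by (auto intro!: LIMSEQ_power_zero)
  ultimately have lim: "(\<lambda>n. \<phi> (1/2 * (1/2) ^ n) / \<phi> ((1/2) ^ n)) \<longlonglongrightarrow> q"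
    by (rule filterlim_compose)
  have "eventually (\<lambda>n. \<phi> (1/2 * (1/2) ^ n) / \<phi> ((1/2) ^ n) < (q + 1) / 2) sequentially"
    "eventually (\<lambda>n. q / 2 < \<phi> (1/2 * (1/2) ^ n) / \<phi> ((1/2) ^ n)) sequentially"
    by (rule order_tendstoD[OF lim]; use q in simp)+
  moreover have "eventually (\<lambda>n. (1/2::real) ^ n < \<delta>) sequentially"
    using \<delta> by (intro order_tendstoD[OF LIMSEQ_power_zero]) auto
  ultimately have "eventually (\<lambda>n. \<phi> ((1/2) ^ Suc n) \<le> (q + 1) / 2 * \<phi> ((1/2) ^ n)
      \<and> \<phi> ((1/2) ^ n) \<le> 2 / q * \<phi> ((1/2) ^ Suc n)) sequentially"
  proof eventually_elim
    case (elim n)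
    have "0 < \<phi> ((1/2) ^ n)" using \<delta> elim by auto
    then show ?case using elim q by (simp add: field_simps)
  qed
  then obtain N where "\<And>n. N \<le> n \<Longrightarrow> \<phi> ((1/2) ^ Suc n) \<le> (q + 1) / 2 * \<phi> ((1/2) ^ n)
      \<and> \<phi> ((1/2) ^ n) \<le> 2 / q * \<phi> ((1/2) ^ Suc n)" by (auto simp: eventually_sequentially)
  then show thesis using q by (intro that[of "(q + 1) / 2" "2 / q" N]) auto
qed

abbreviation loglog :: "nat \<Rightarrow> real" where
  "loglog n \<equiv> ln (ln (1 / (1/2) ^ n))"

lemma loglog_eq: "loglog n = ln (real n * ln 2)"
proof -
  have "ln (1 / (1/2) ^ n) = real n * ln 2" by (simp add: power_divide ln_realpow)
  then show ?thesis by simp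
qed

lemma loglog_at_top: "filterlim loglog at_top sequentially"
proof -
  have "filterlim (\<lambda>n. real n * ln 2) at_top sequentially"
    by (rule filterlim_at_top_mult_tendsto_pos[OF tendsto_const]) (auto intro: filterlim_real_sequentially)
  then show ?thesis unfolding loglog_eq by (rule filterlim_compose[OF ln_at_top])
qed

lemma loglog_pos: "eventually (\<lambda>n. 0 < loglog n) sequentially"
  using loglog_at_top unfolding filterlim_at_top_dense by blast

lemma loglog_mono_scale:
  assumes "0 < loglog n" "0 < n" "0 < h" "h \<le> (1/2) ^ n"
  shows "sqrt (loglog n) \<le> sqrt (ln (ln (1 / h)))"
proof -
  have n1: "0 < ln (1 / (1/2::real) ^ n)"
    using assms(2) by (simp add: power_divide ln_realpow)
  have le: "1 / (1/2) ^ n \<le> 1 / h" using assms by (intro divide_left_mono) auto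
  then have "ln (1 / (1/2) ^ n) \<le> ln (1 / h)" by (rule ln_mono) simp
  then have "loglog n \<le> ln (ln (1 / h))" using n1 by (rule ln_mono)
  then show ?thesis by simp
qed

lemma loglog_inverse_pos:
  fixes h :: real
  assumes "0 < h" "h < 1 / 4"
  shows "0 < ln (ln (1 / h))"
proof -
  have "4 < 1 / h" using assms by (simp add: field_simps)
  then have "exp 1 < 1 / h" using exp_le by linarith
  then have "ln (exp 1) < ln (1 / h)" using assms by (subst ln_less_cancel_iff) auto
  then show ?thesis by simp
qed

text \<open>
  The factor \<open>exp(-c log log 2\<^sup>n)\<close> is a constant times \<open>n\<close> to the power \<open>-c\<close>.
\<close>

lemma (in prob_space) borel_cantelli_loglog:
  assumes A: "\<And>n. A n \<in> events" and c: "1 < c"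
    and bound: "eventually (\<lambda>n. prob (A n) \<le> K * exp (- c * loglog n)) sequentially"
  shows "AE \<omega> in M. eventually (\<lambda>n. \<omega> \<notin> A n) sequentially"
proof -
  have "summable (\<lambda>n. K * (ln 2 powr (- c) * real n powr (- c)))"
    using c by (intro summable_mult) (simp add: summable_real_powr_iff)
  moreover have "eventually (\<lambda>n. norm (prob (A n)) \<le> K * (ln 2 powr (- c) * real n powr (- c))) sequentially"
    using bound eventually_gt_at_top[of 0]
  proof eventually_elim
    case (elim n)
    have "exp (- c * loglog n) = (real n * ln 2) powr (- c)"
      using elim by (simp add: loglog_eq powr_def)
    also have "\<dots> = ln 2 powr (- c) * real n powr (- c)" by (simp add: powr_mult mult.commute)
    finally show ?case using elim by simp
  qed
  ultimately have "summable (\<lambda>n. prob (A n))" by (rule summable_comparison_test_ev[rotated])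
  then have "AE \<omega> in M. eventually (\<lambda>n. \<omega> \<in> space M - A n) sequentially"
    by (intro borel_cantelli_AE1 A) (auto simp: emeasure_eq_measure)
  then show ?thesis by eventually_elim (auto elim: eventually_mono)
qed

text \<open>
  Used to prove statements about all small \<open>h\<close> one dyadic block at a time.
\<close>

lemma eventually_at_right_dyadic:
  assumes "eventually (\<lambda>n. \<forall>h. (1/2) ^ Suc n < h \<longrightarrow> h \<le> (1/2) ^ n \<longrightarrow> P h) sequentially"
  shows "eventually P (at_right (0::real))"
proof -
  obtain N where N: "\<And>n h. N \<le> n \<Longrightarrow> (1/2) ^ Suc n < h \<Longrightarrow> h \<le> (1/2) ^ n \<Longrightarrow> P h"
    using assms by (auto simp: eventually_sequentially)
  have "P h" if h: "0 < h" "h < (1/2) ^ N" for h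
  proof -
    obtain k where "(1/2) ^ k < h" using real_arch_pow_inv[OF h(1), of "1/2"] by auto
    then have ex: "\<exists>k. (1/2) ^ k < h" by blast
    define k0 where "k0 = (LEAST k. (1/2) ^ k < h)"
    have k0: "(1/2) ^ k0 < h" unfolding k0_def using ex by (rule LeastI_ex)
    have "N < k0"
    proof (rule ccontr)
      assume "\<not> N < k0"
      then have "(1/2::real) ^ N \<le> (1/2) ^ k0" by (intro power_decreasing) auto
      then show False using k0 h by linarith
    qed
    then obtain n where n: "k0 = Suc n" "N \<le> n" by (metis Suc_le_D Suc_le_eq Suc_le_mono)
    have "\<not> (1/2) ^ n < h" using n(1) not_less_Least[of n "\<lambda>k. (1/2) ^ k < h"] by (simp add: k0_def[symmetric])
    then show ?thesis using N[OF n(2)] k0 n(1) by simp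
  qed
  then show ?thesis unfolding eventually_at_right_field by (intro exI[of _ "(1/2) ^ N"]) auto
qed

lemma Limsup_le_limit:
  assumes "\<And>k::nat. eventually (\<lambda>x. f x \<le> ereal (c k)) F" "c \<longlonglongrightarrow> l"
  shows "Limsup F f \<le> ereal l"
proof (rule LIMSEQ_le_const)
  show "(\<lambda>k. ereal (c k)) \<longlonglongrightarrow> ereal l" using assms(2) by simp
  show "\<exists>N. \<forall>n\<ge>N. Limsup F f \<le> ereal (c n)" using assms(1) Limsup_bounded by blast
qed

lemma ratio_le_square:
  assumes "0 \<le> x" "0 < a" "0 < l" "sqrt x \<le> c * sqrt a * sqrt l" 
  shows "x / (a * l) \<le> c\<^sup>2"
proof -
  have "(sqrt x)\<^sup>2 \<le> (c * sqrt a * sqrt l)\<^sup>2" using assms by (intro power_mono) auto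
  then have "x \<le> c\<^sup>2 * (a * l)" using assms by (simp add: power_mult_distrib)
  then show ?thesis using assms by (simp add: pos_divide_le_eq)
qed

section \<open>Chaining\<close>

text \<open>
  The increments of level \<open>k\<close> on \<open>[0, 2\<^sup>-\<^sup>n]\<close> number \<open>2\<^sup>k\<close>; allowing each of them
  \<open>z\<^sup>2 = 4 (log log 2\<^sup>n + k)\<close> makes the probabilities summable over \<open>k\<close> and over \<open>n\<close>. The allowed
  increments of level \<open>k\<close> are of size \<open>r\<^sup>k (1 + k)\<close> relative to \<open>\<phi>(2\<^sup>-\<^sup>n) (log log 2\<^sup>n)\<^sup>1\<^sup>/\<^sup>2\<close>, and the
  tail of this convergent series is small.
\<close>

lemma (in prob_space) dyadic_local_modulus:
  fixes Z :: "real \<Rightarrow> 'a \<Rightarrow> real" and \<phi> :: "real \<Rightarrow> real"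
  assumes meas: "\<And>t. t \<in> {0..1} \<Longrightarrow> Z t \<in> borel_measurable M"
    and cont: "\<And>\<omega>. \<omega> \<in> space M \<Longrightarrow> continuous_on {0..1} (\<lambda>t. Z t \<omega>)"
    and K: "0 \<le> K"
    and tail: "\<And>s t z. s \<in> {0..1} \<Longrightarrow> t \<in> {0..1} \<Longrightarrow> s < t \<Longrightarrow> 0 < z \<Longrightarrow>
      prob {\<omega> \<in> space M. \<phi> (t - s) * z \<le> \<bar>Z t \<omega> - Z s \<omega>\<bar>} \<le> K * exp (- (z\<^sup>2 / 2))"
    and pos: "\<And>n. 0 < \<phi> ((1/2) ^ n)"
    and r: "0 < r" "r < 1"
    and decay: "\<And>n k. N \<le> n \<Longrightarrow> \<phi> ((1/2) ^ (n + k)) \<le> r ^ k * \<phi> ((1/2) ^ n)"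
    and \<epsilon>: "0 < \<epsilon>"
  obtains m0 where "\<And>m. m0 \<le> m \<Longrightarrow> AE \<omega> in M. eventually (\<lambda>n. \<forall>t\<in>{0..(1/2) ^ n}.
    \<bar>Z t \<omega> - Z (grid (n + m) t) \<omega>\<bar> \<le> \<epsilon> * \<phi> ((1/2) ^ n) * sqrt (loglog n)) sequentially"
proof -
  define w where "w k = 2 * r ^ k * (1 + real k)" for k
  have "summable (\<lambda>k. real (Suc k) * r ^ k)"
    using geometric_deriv_sums[of r] r by (auto simp: sums_iff)
  then have "summable (\<lambda>k. 2 * (real (Suc k) * r ^ k))" by (rule summable_mult)
  moreover have "w = (\<lambda>k. 2 * (real (Suc k) * r ^ k))" by (simp add: w_def fun_eq_iff)
  ultimately have w_sum: "summable w" by simp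
  obtain m0 where m0: "\<And>m. m0 \<le> m \<Longrightarrow> \<bar>\<Sum>k. w (k + m)\<bar> < \<epsilon>"
    using suminf_exist_split[OF \<epsilon> w_sum] by auto
  define pt where "pt n k i = (1/2) ^ n * (real i / 2 ^ k)" for n k i :: nat
  have pt01: "pt n k i \<in> {0..1}" if "i \<le> 2 ^ k" for n k i
    unfolding pt_def using that by (rule grid_01)
  define z where "z n k = 2 * sqrt (loglog n + real k)" for n k
  define E where "E n k i = {\<omega> \<in> space M.
      \<phi> ((1/2) ^ (n + k)) * z n k \<le> \<bar>Z (pt n k (Suc i)) \<omega> - Z (pt n k i) \<omega>\<bar>}" for n k i
  define F where "F n k = (\<Union>i\<in>{..<2 ^ k}. E n k i)" for n k
  define B where "B n = (\<Union>k. F n k)" for n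
  have E_meas: "E n k i \<in> events" if "i < 2 ^ k" for n k i
  proof -
    have [measurable]: "Z (pt n k (Suc i)) \<in> borel_measurable M" "Z (pt n k i) \<in> borel_measurable M"
      using that by (auto intro!: meas pt01)
    show ?thesis unfolding E_def by measurable
  qed
  have F_meas: "F n k \<in> events" for n k
    unfolding F_def by (intro sets.finite_UN E_meas) auto
  have B_meas: "B n \<in> events" for n
    unfolding B_def using F_meas by auto
  have F_prob: "prob (F n k) \<le> K * exp (- 2 * loglog n) * (1/2) ^ k" if "1 \<le> loglog n" for n k
  proof -
    have "prob (F n k) \<le> (\<Sum>i\<in>{..<2 ^ k}. prob (E n k i))"
      unfolding F_def by (intro finite_measure_subadditive_finite) (auto intro: E_meas)
    also have "\<dots> \<le> (\<Sum>i\<in>{..<2 ^ k::nat}. K * exp (- (2 * (loglog n + real k))))"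
    proof (intro sum_mono)
      fix i :: nat assume "i \<in> {..<2 ^ k}"
      then have i: "i < 2 ^ k" by simp
      have diff: "pt n k (Suc i) - pt n k i = (1/2) ^ (n + k)"
        by (simp add: pt_def power_add add_divide_distrib power_one_over algebra_simps)
      then have lt: "pt n k i < pt n k (Suc i)"
        using zero_less_power[of "1/2::real" "n + k"] by linarith
      have "prob (E n k i) \<le> K * exp (- ((z n k)\<^sup>2 / 2))"
        unfolding E_def diff[symmetric]
        using i lt that by (intro tail pt01) (auto simp: z_def)
      also have "(z n k)\<^sup>2 / 2 = 2 * (loglog n + real k)"
        using that by (simp add: z_def power_mult_distrib)
      finally show "prob (E n k i) \<le> K * exp (- (2 * (loglog n + real k)))" .
    qed
    also have "\<dots> = 2 ^ k * (K * exp (- (2 * (loglog n + real k))))" by simp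
    also have "\<dots> = K * exp (- 2 * loglog n) * (2 * exp (- 2)) ^ k"
    proof -
      have "exp (- (2 * (loglog n + real k))) = exp (- 2 * loglog n) * exp (real k * - 2)"
        unfolding exp_add[symmetric] by (simp add: algebra_simps)
      then show ?thesis unfolding exp_of_nat_mult by (simp add: power_mult_distrib mult_ac)
    qed
    also have "\<dots> \<le> K * exp (- 2 * loglog n) * (1/2) ^ k"
    proof (intro mult_left_mono power_mono)
      have "(2::real)\<^sup>2 \<le> (exp 1)\<^sup>2" using exp_ge_add_one_self[of 1] by (intro power_mono) auto
      then have "4 \<le> exp (2::real)" by (simp add: exp_double[symmetric])
      then show "2 * exp (- 2) \<le> (1/2::real)" by (simp add: exp_minus field_simps)
    qed (use K in auto)
    finally show ?thesis .
  qed
  have B_prob: "prob (B n) \<le> 2 * K * exp (- 2 * loglog n)" if "1 \<le> loglog n" for n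
  proof -
    have g: "(\<lambda>k. K * exp (- 2 * loglog n) * (1/2) ^ k) sums (K * exp (- 2 * loglog n) * (1 / (1 - 1/2)))"
      by (intro sums_mult geometric_sums) auto
    have s: "summable (\<lambda>k. prob (F n k))"
      by (rule summable_comparison_test'[OF sums_summable[OF g], of 0]) (use F_prob[OF that] in auto)
    have "prob (B n) \<le> (\<Sum>k. prob (F n k))"
      unfolding B_def using F_meas s by (intro finite_measure_subadditive_countably) auto
    also have "\<dots> \<le> (\<Sum>k. K * exp (- 2 * loglog n) * (1/2) ^ k)"
      by (intro suminf_le F_prob that s sums_summable[OF g])
    also have "\<dots> = 2 * K * exp (- 2 * loglog n)"
      using sums_unique[OF g] by simp
    finally show ?thesis .
  qed
  have L1: "eventually (\<lambda>n. 1 \<le> loglog n) sequentially"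
    using loglog_at_top unfolding filterlim_at_top by blast
  have good: "AE \<omega> in M. eventually (\<lambda>n. \<omega> \<notin> B n) sequentially"
    by (rule borel_cantelli_loglog[where c = 2 and K = "2 * K", OF B_meas])
       (use eventually_mono[OF L1 B_prob] in simp_all)
  show thesis
  proof (rule that[of m0])
    fix m assume m: "m0 \<le> m"
    show "AE \<omega> in M. eventually (\<lambda>n. \<forall>t\<in>{0..(1/2) ^ n}.
        \<bar>Z t \<omega> - Z (grid (n + m) t) \<omega>\<bar> \<le> \<epsilon> * \<phi> ((1/2) ^ n) * sqrt (loglog n)) sequentially"
      using good AE_space
    proof eventually_elim
      case (elim \<omega>)
      from elim(1) L1 eventually_ge_at_top[of N] show ?case
      proof eventually_elim
        case (elim n)
        define h where "h = (1/2::real) ^ n"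
        have h: "0 < h" "h \<le> 1" by (auto simp: h_def power_le_one)
        define S where "S = \<phi> h * sqrt (loglog n)"
        have S: "0 \<le> S" using pos[of n] elim(2) by (simp add: S_def h_def)
        have inc: "\<bar>Z (h * (real (Suc i) / 2 ^ k)) \<omega> - Z (h * (real i / 2 ^ k)) \<omega>\<bar> \<le> S * w k"
          if i: "i < 2 ^ k" for k i
        proof -
          have "\<omega> \<notin> E n k i" using elim(1) i by (auto simp: B_def F_def)
          then have "\<bar>Z (pt n k (Suc i)) \<omega> - Z (pt n k i) \<omega>\<bar> \<le> \<phi> ((1/2) ^ (n + k)) * z n k"
            using \<open>\<omega> \<in> space M\<close> by (auto simp: E_def)
          also have "\<dots> \<le> (r ^ k * \<phi> h) * (2 * (sqrt (loglog n) * (1 + real k)))"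
          proof (intro mult_mono)
            show "\<phi> ((1/2) ^ (n + k)) \<le> r ^ k * \<phi> h" using decay elim(3) by (simp add: h_def)
            have "loglog n + real k \<le> loglog n * (1 + real k)"
              using mult_right_mono[OF elim(2), of "real k"] by (simp add: algebra_simps)
            also have "\<dots> \<le> loglog n * (1 + real k)\<^sup>2"
              using elim(2) by (intro mult_left_mono) (auto simp: power2_eq_square)
            finally have "sqrt (loglog n + real k) \<le> sqrt (loglog n * (1 + real k)\<^sup>2)" by simp
            then show "z n k \<le> 2 * (sqrt (loglog n) * (1 + real k))"
              by (simp add: z_def real_sqrt_mult)
            show "0 \<le> r ^ k * \<phi> h" using r pos[of n] by (simp add: h_def)
            show "0 \<le> z n k" using elim(2) by (simp add: z_def)
          qed
          also have "\<dots> = S * w k" by (simp add: S_def w_def)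
          finally show ?thesis by (simp add: pt_def h_def)
        qed
        show ?case
        proof
          fix t :: real assume t: "t \<in> {0..(1/2) ^ n}"
          define x where "x = t / h"
          have x: "x \<in> {0..1}" "t = h * x" using t h by (auto simp: x_def h_def[symmetric])
          have "continuous_on {0..1} (\<lambda>x. Z (h * x) \<omega>)"
            using h by (intro continuous_on_compose2[OF cont[OF \<open>\<omega> \<in> space M\<close>]] continuous_intros)
              (auto intro: mult_le_one)
          then have "\<bar>Z (h * x) \<omega> - Z (h * grid m x) \<omega>\<bar> \<le> (\<Sum>k. S * w (k + Suc m))"
            using x inc w_sum
            by (intro dyadic_chaining[where f = "\<lambda>x. Z (h * x) \<omega>" and e = "\<lambda>k. S * w k"])
               (auto intro!: summable_mult simp: summable_iff_shift[of w "Suc m", simplified])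
          also have "\<dots> = S * (\<Sum>k. w (k + Suc m))"
            using w_sum summable_iff_shift[of w "Suc m"] by (intro suminf_mult) auto
          also have "\<dots> \<le> S * \<epsilon>"
            using m0[of "Suc m"] m S by (intro mult_left_mono) auto
          also have "h * grid m x = grid (n + m) t"
          proof -
            have eq: "2 ^ (n + m) * t = 2 ^ m * x" by (simp add: x(2) h_def power_add power_one_over)
            show ?thesis unfolding grid_def eq by (simp add: h_def power_add power_one_over)
          qed
          finally have "\<bar>Z (h * x) \<omega> - Z (grid (n + m) t) \<omega>\<bar> \<le> S * \<epsilon>" .
          then show "\<bar>Z t \<omega> - Z (grid (n + m) t) \<omega>\<bar> \<le> \<epsilon> * \<phi> ((1/2) ^ n) * sqrt (loglog n)"
            unfolding x(2)[symmetric] by (simp add: S_def h_def mult_ac)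
        qed
      qed
    qed
  qed
qed

section \<open>Oscillation of the square root process at the origin\<close>

locale permanental_path = prob_space M for M :: "'a measure" +
  fixes \<alpha> :: real and X :: "real \<Rightarrow> 'a \<Rightarrow> real" and u :: "real \<Rightarrow> real \<Rightarrow> real"
    and \<phi> :: "real \<Rightarrow> real" and \<rho> :: real
  assumes \<alpha>: "0 < \<alpha>"
    and process: "permanental_process M \<alpha> {0..1} X u"
    and paths: "\<And>\<omega>. \<omega> \<in> space M \<Longrightarrow> continuous_on {0..1} (\<lambda>t. X t \<omega>)"
    and mono: "mono_on {0..1} \<phi>"
    and sigma_le: "\<And>s t. s \<in> {0..1} \<Longrightarrow> t \<in> {0..1} \<Longrightarrow> sigma_fun u s t \<le> \<phi> \<bar>t - s\<bar>"
    and \<rho>: "0 < \<rho>" and regvar: "regularly_varying_at_zero \<phi> \<rho>"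
begin

lemma X_meas [measurable]: "t \<in> {0..1} \<Longrightarrow> X t \<in> borel_measurable M"
  and X_nonneg: "t \<in> {0..1} \<Longrightarrow> \<omega> \<in> space M \<Longrightarrow> 0 \<le> X t \<omega>"
  and u_nonneg: "t \<in> {0..1} \<Longrightarrow> 0 \<le> u t t"
  and X_laplace: "t \<in> {0..1} \<Longrightarrow> 0 < s \<Longrightarrow> (\<integral>\<omega>. exp (- s * X t \<omega>) \<partial>M) = (1 + u t t * s) powr (- \<alpha>)"
  using permanental_process_marginal[OF process] by blast+

lemma phi_mono: "0 \<le> s \<Longrightarrow> s \<le> t \<Longrightarrow> t \<le> 1 \<Longrightarrow> \<phi> s \<le> \<phi> t"
  using mono by (auto simp: mono_on_def)

lemma phi_pos: "0 < \<phi> x" if "0 < x" "x \<le> 1"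
proof -
  obtain \<delta> where \<delta>: "0 < \<delta>" "\<And>x. 0 < x \<Longrightarrow> x < \<delta> \<Longrightarrow> 0 < \<phi> x"
    using regvar unfolding regularly_varying_at_zero_def by auto
  have "0 < \<phi> (min x (\<delta> / 2))" using \<delta> that by (intro \<delta>(2)) auto
  also have "\<dots> \<le> \<phi> x" using \<delta> that by (intro phi_mono) auto
  finally show ?thesis .
qed

text \<open>
  The sigma function dominates the increments of the square root of the diagonal, as the standard
  deviation of a difference dominates the difference of the standard deviations.
\<close>

lemma sqrt_u_diff_le: "\<bar>sqrt (u s s) - sqrt (u t t)\<bar> \<le> \<phi> \<bar>t - s\<bar>" if "s \<in> {0..1}" "t \<in> {0..1}"
proof -
  have "u s t * u t s \<le> u s s * u t t"
    using permanental_process_bivariate[OF process that] by (simp add: bivariate_permanental_def)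
  note sig = sigma_fun_square[OF u_nonneg u_nonneg this, OF that]
  have "\<bar>sqrt (u s s) - sqrt (u t t)\<bar> \<le> sigma_fun u s t"
    using sig(1,3) by (simp add: abs_le_square_iff[symmetric])
  then show ?thesis using sigma_le[OF that] by linarith
qed

lemma increment_tail:
  assumes "0 < r" "r < 1"
  obtains K where "0 \<le> K" "\<And>s t z. s \<in> {0..1} \<Longrightarrow> t \<in> {0..1} \<Longrightarrow> s < t \<Longrightarrow> 0 < z \<Longrightarrow>
    prob {\<omega> \<in> space M. \<phi> (t - s) * z \<le> \<bar>sqrt (X t \<omega>) - sqrt (X s \<omega>)\<bar>} \<le> K * exp (- r\<^sup>2 * z\<^sup>2)"
proof -
  obtain K where K: "0 \<le> K" "\<And>s t v z. s \<in> {0..1} \<Longrightarrow> t \<in> {0..1} \<Longrightarrow> 0 < v \<Longrightarrow> sigma_fun u s t \<le> v \<Longrightarrow> 0 < z \<Longrightarrow>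
    prob {\<omega> \<in> space M. v * z \<le> \<bar>sqrt (X s \<omega>) - sqrt (X t \<omega>)\<bar>} \<le> K * exp (- r\<^sup>2 * z\<^sup>2)"
    using permanental_increment_tail[OF process \<alpha> assms] by blast
  show thesis
  proof (rule that[OF K(1)])
    fix s t z :: real assume st: "s \<in> {0..1}" "t \<in> {0..1}" "s < t" and z: "0 < z"
    have "prob {\<omega> \<in> space M. \<phi> (t - s) * z \<le> \<bar>sqrt (X s \<omega>) - sqrt (X t \<omega>)\<bar>} \<le> K * exp (- r\<^sup>2 * z\<^sup>2)"
      using st z sigma_le[OF st(1,2)] by (intro K(2) phi_pos) auto
    then show "prob {\<omega> \<in> space M. \<phi> (t - s) * z \<le> \<bar>sqrt (X t \<omega>) - sqrt (X s \<omega>)\<bar>} \<le> K * exp (- r\<^sup>2 * z\<^sup>2)"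
      by (simp add: abs_minus_commute)
  qed
qed

lemma phi_dyadic:
  obtains r C N where "0 < r" "r < 1" "0 < C"
    "\<And>n k. N \<le> n \<Longrightarrow> \<phi> ((1/2) ^ (n + k)) \<le> r ^ k * \<phi> ((1/2) ^ n)"
    "\<And>n h. N \<le> n \<Longrightarrow> (1/2) ^ Suc n < h \<Longrightarrow> h \<le> (1/2) ^ n \<Longrightarrow> \<phi> ((1/2) ^ n) \<le> C * \<phi> h"
proof -
  obtain r C N where *: "0 < r" "r < 1" "0 < C"
    "\<And>n. N \<le> n \<Longrightarrow> \<phi> ((1/2) ^ Suc n) \<le> r * \<phi> ((1/2) ^ n)"
    "\<And>n. N \<le> n \<Longrightarrow> \<phi> ((1/2) ^ n) \<le> C * \<phi> ((1/2) ^ Suc n)"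
    using regularly_varying_dyadic[OF regvar \<rho>] by blast
  show thesis
  proof (rule that[OF *(1-3), of N])
    show "\<phi> ((1/2) ^ (n + k)) \<le> r ^ k * \<phi> ((1/2) ^ n)" if "N \<le> n" for n k
    proof (induction k)
      case (Suc k)
      have "\<phi> ((1/2) ^ (n + Suc k)) \<le> r * \<phi> ((1/2) ^ (n + k))" using *(4)[of "n + k"] that by simp
      also have "\<dots> \<le> r * (r ^ k * \<phi> ((1/2) ^ n))" using Suc *(1) by (intro mult_left_mono) auto
      finally show ?case by simp
    qed simp
    show "\<phi> ((1/2) ^ n) \<le> C * \<phi> h" if "N \<le> n" "(1/2) ^ Suc n < h" "h \<le> (1/2) ^ n" for n h
    proof -
      have "\<phi> ((1/2) ^ n) \<le> C * \<phi> ((1/2) ^ Suc n)" by (rule *(5)) fact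
      also have "\<dots> \<le> C * \<phi> h"
      proof (intro mult_left_mono phi_mono)
        show "h \<le> 1" using that(3) power_le_one[of "1/2::real" n] by linarith
      qed (use that *(3) in auto)
      finally show ?thesis .
    qed
  qed
qed

lemma local_modulus:
  assumes "0 < \<epsilon>"
  obtains m0 where "\<And>m. m0 \<le> m \<Longrightarrow> AE \<omega> in M. eventually (\<lambda>n. \<forall>t\<in>{0..(1/2) ^ n}.
    \<bar>sqrt (X t \<omega>) - sqrt (X (grid (n + m) t) \<omega>)\<bar> \<le> \<epsilon> * \<phi> ((1/2) ^ n) * sqrt (loglog n)) sequentially"
proof -
  obtain r C N where rCN: "0 < r" "r < 1" "\<And>n k. N \<le> n \<Longrightarrow> \<phi> ((1/2) ^ (n + k)) \<le> r ^ k * \<phi> ((1/2) ^ n)"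
    using phi_dyadic by metis
  obtain K where K: "0 \<le> K" "\<And>s t z. s \<in> {0..1} \<Longrightarrow> t \<in> {0..1} \<Longrightarrow> s < t \<Longrightarrow> 0 < z \<Longrightarrow>
    prob {\<omega> \<in> space M. \<phi> (t - s) * z \<le> \<bar>sqrt (X t \<omega>) - sqrt (X s \<omega>)\<bar>} \<le> K * exp (- (3/4)\<^sup>2 * z\<^sup>2)"
    \<comment> \<open>Any \<open>r\<close> with \<open>1/2 \<le> r\<^sup>2 < 1\<close> would do.\<close>
    using increment_tail[of "3/4"] by auto
  show thesis
  proof (rule dyadic_local_modulus[where Z = "\<lambda>t \<omega>. sqrt (X t \<omega>)" and \<phi> = \<phi> and r = r and N = N and K = K and \<epsilon> = \<epsilon>])
    fix s t z :: real assume st: "s \<in> {0..1}" "t \<in> {0..1}" "s < t" "0 < z"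
    have "prob {\<omega> \<in> space M. \<phi> (t - s) * z \<le> \<bar>sqrt (X t \<omega>) - sqrt (X s \<omega>)\<bar>} \<le> K * exp (- (3/4)\<^sup>2 * z\<^sup>2)"
      by (rule K) fact+
    also have "\<dots> \<le> K * exp (- (z\<^sup>2 / 2))"
      using K(1) by (intro mult_left_mono) (auto simp: power2_eq_square)
    finally show "prob {\<omega> \<in> space M. \<phi> (t - s) * z \<le> \<bar>sqrt (X t \<omega>) - sqrt (X s \<omega>)\<bar>} \<le> K * exp (- (z\<^sup>2 / 2))" .
  next
    show "continuous_on {0..1} (\<lambda>t. sqrt (X t \<omega>))" if "\<omega> \<in> space M" for \<omega>
      using paths[OF that] by (intro continuous_intros)
  qed (use that rCN K(1) assms in \<open>auto intro!: phi_pos power_le_one\<close>)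
qed

text \<open>
  The tail exponent \<open>r\<^sup>2 z\<^sup>2\<close> with \<open>r\<^sup>2 = 1/(1 + \<epsilon>)\<close> and \<open>z = (1 + \<epsilon>) (log log 2\<^sup>n)\<^sup>1\<^sup>/\<^sup>2\<close> equals
  \<open>(1 + \<epsilon>) log log 2\<^sup>n\<close>, just enough for Borel-Cantelli. For fixed \<open>m\<close> there are finitely many \<open>i\<close>, so
  they need not be treated uniformly.
\<close>

lemma grid_increments:
  assumes \<epsilon>: "0 < \<epsilon>"
  shows "AE \<omega> in M. eventually (\<lambda>n. \<forall>i\<in>{1..2 ^ m}.
    \<bar>sqrt (X ((1/2) ^ n * (real i / 2 ^ m)) \<omega>) - sqrt (X 0 \<omega>)\<bar>
      \<le> \<phi> ((1/2) ^ n * (real i / 2 ^ m)) * ((1 + \<epsilon>) * sqrt (loglog n))) sequentially"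
proof -
  define r where "r = 1 / sqrt (1 + \<epsilon>)"
  have r: "0 < r" "r < 1" "r\<^sup>2 = 1 / (1 + \<epsilon>)" using \<epsilon> by (auto simp: r_def power_divide)
  obtain K where K: "0 \<le> K" "\<And>s t z. s \<in> {0..1} \<Longrightarrow> t \<in> {0..1} \<Longrightarrow> s < t \<Longrightarrow> 0 < z \<Longrightarrow>
    prob {\<omega> \<in> space M. \<phi> (t - s) * z \<le> \<bar>sqrt (X t \<omega>) - sqrt (X s \<omega>)\<bar>} \<le> K * exp (- r\<^sup>2 * z\<^sup>2)"
    using increment_tail[OF r(1,2)] by blast
  have "AE \<omega> in M. eventually (\<lambda>n. 
    \<bar>sqrt (X ((1/2) ^ n * (real i / 2 ^ m)) \<omega>) - sqrt (X 0 \<omega>)\<bar>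
      \<le> \<phi> ((1/2) ^ n * (real i / 2 ^ m)) * ((1 + \<epsilon>) * sqrt (loglog n))) sequentially"
    if i: "i \<in> {1..2 ^ m}" for i :: nat
  proof -
    define g where "g n = (1/2) ^ n * (real i / 2 ^ m)" for n
    have g: "g n \<in> {0..1}" "0 < g n" for n using grid_01[of i m n] i by (auto simp: g_def)
    have [measurable]: "X (g n) \<in> borel_measurable M" "X 0 \<in> borel_measurable M" for n
      using g by (auto intro!: X_meas)
    define A where "A n = {\<omega> \<in> space M. \<phi> (g n - 0) * ((1 + \<epsilon>) * sqrt (loglog n))
        \<le> \<bar>sqrt (X (g n) \<omega>) - sqrt (X 0 \<omega>)\<bar>}" for n
    have "AE \<omega> in M. eventually (\<lambda>n. \<omega> \<notin> A n) sequentially"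
    proof (rule borel_cantelli_loglog[where c = "1 + \<epsilon>" and K = K])
      show "A n \<in> events" for n unfolding A_def by measurable
      show "eventually (\<lambda>n. prob (A n) \<le> K * exp (- (1 + \<epsilon>) * loglog n)) sequentially"
        using loglog_pos
      proof eventually_elim
        case (elim n)
        have "prob (A n) \<le> K * exp (- r\<^sup>2 * ((1 + \<epsilon>) * sqrt (loglog n))\<^sup>2)"
          unfolding A_def using g \<epsilon> elim by (intro K) auto
        also have "- r\<^sup>2 * ((1 + \<epsilon>) * sqrt (loglog n))\<^sup>2 = - (1 + \<epsilon>) * loglog n"
        proof -
          have "((1 + \<epsilon>) * sqrt (loglog n))\<^sup>2 = (1 + \<epsilon>) * ((1 + \<epsilon>) * loglog n)"
            unfolding power_mult_distrib using elim by (simp add: power2_eq_square)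
          moreover have "1 / (1 + \<epsilon>) * ((1 + \<epsilon>) * ((1 + \<epsilon>) * loglog n)) = (1 + \<epsilon>) * loglog n"
            using \<epsilon> by simp
          ultimately show ?thesis unfolding r(3) by (simp only: mult_minus_left)
        qed
        finally show ?case .
      qed
    qed (use \<epsilon> in auto)
    then show ?thesis
      using AE_space by eventually_elim (auto simp: A_def g_def elim!: eventually_mono)
  qed
  then have "AE \<omega> in M. \<forall>i\<in>{1..2 ^ m}. eventually (\<lambda>n. 
    \<bar>sqrt (X ((1/2) ^ n * (real i / 2 ^ m)) \<omega>) - sqrt (X 0 \<omega>)\<bar>
      \<le> \<phi> ((1/2) ^ n * (real i / 2 ^ m)) * ((1 + \<epsilon>) * sqrt (loglog n))) sequentially"
    by (intro AE_finite_allI) auto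
  then show ?thesis by eventually_elim (rule eventually_ball_finite, auto)
qed

text \<open>
  The bound at a grid point \<open>g \<le> t\<close> involves \<open>\<phi>(g)\<close>, which is at most \<open>\<phi>(h)\<close> by monotonicity;
  therefore the ratio 2 of the dyadic scales does not spoil the constant. It only enters through
  the chaining remainder, which carries an arbitrarily small factor.
\<close>

lemma sqrt_increment_loglog:
  assumes \<epsilon>: "0 < \<epsilon>"
  shows "AE \<omega> in M. eventually (\<lambda>h. \<forall>t\<in>{0..h}.
    \<bar>sqrt (X t \<omega>) - sqrt (X 0 \<omega>)\<bar> \<le> (1 + \<epsilon>) * \<phi> h * sqrt (ln (ln (1 / h)))) (at_right 0)"
proof -
  obtain r C N where C: "0 < C"
    "\<And>n h. N \<le> n \<Longrightarrow> (1/2) ^ Suc n < h \<Longrightarrow> h \<le> (1/2) ^ n \<Longrightarrow> \<phi> ((1/2) ^ n) \<le> C * \<phi> h"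
    using phi_dyadic by metis
  define \<delta> where "\<delta> = \<epsilon> / (2 * C)"
  have \<delta>: "0 < \<delta>" using \<epsilon> C by (simp add: \<delta>_def)
  obtain m where m: "AE \<omega> in M. eventually (\<lambda>n. \<forall>t\<in>{0..(1/2) ^ n}.
    \<bar>sqrt (X t \<omega>) - sqrt (X (grid (n + m) t) \<omega>)\<bar> \<le> \<delta> * \<phi> ((1/2) ^ n) * sqrt (loglog n)) sequentially"
    using local_modulus[OF \<delta>] by blast
  have "0 < \<epsilon> / 2" using \<epsilon> by simp
  from m grid_increments[OF this, of m] show ?thesis
  proof eventually_elim
    case (elim \<omega>)
    show ?case
    proof (rule eventually_at_right_dyadic)
      show "eventually (\<lambda>n. \<forall>h. (1/2) ^ Suc n < h \<longrightarrow> h \<le> (1/2) ^ n \<longrightarrow> (\<forall>t\<in>{0..h}.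
          \<bar>sqrt (X t \<omega>) - sqrt (X 0 \<omega>)\<bar> \<le> (1 + \<epsilon>) * \<phi> h * sqrt (ln (ln (1 / h))))) sequentially"
        using elim(1,2) loglog_pos eventually_gt_at_top[of 0] eventually_ge_at_top[of N]
      proof eventually_elim
        case (elim n)
        show ?case
        proof (intro allI impI ballI)
          fix h t :: real assume h: "(1/2) ^ Suc n < h" "h \<le> (1/2) ^ n" and t: "t \<in> {0..h}"
          have h0: "0 < h" using h(1) zero_less_power[of "1/2::real" "Suc n"] by linarith
          have h1: "h \<le> 1" using h(2) power_le_one[of "1/2::real" n] by linarith
          define g where "g = grid (n + m) t"
          define l where "l = sqrt (loglog n)"
          have l: "0 \<le> l" "l \<le> sqrt (ln (ln (1 / h)))"
            using loglog_mono_scale[OF elim(3,4) h0 h(2)] elim(3) by (auto simp: l_def)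
          have g: "0 \<le> g" "g \<le> t" using grid_bounds[of t "n + m"] t by (auto simp: g_def)
          have \<phi>h: "0 < \<phi> h" by (rule phi_pos) fact+
          have 1: "\<bar>sqrt (X g \<omega>) - sqrt (X 0 \<omega>)\<bar> \<le> \<phi> h * ((1 + \<epsilon> / 2) * l)"
          proof (cases "g = 0")
            case True
            then show ?thesis using \<phi>h l \<epsilon> by simp
          next
            case False
            have "0 \<le> t" "t \<le> (1/2) ^ n" using t h by auto
            then obtain i where i: "i \<le> 2 ^ m" "g = (1/2) ^ n * (real i / 2 ^ m)"
              unfolding g_def by (rule grid_point)
            then have "i \<in> {1..2 ^ m}" using False by (cases i) auto
            with elim(2) have "\<bar>sqrt (X g \<omega>) - sqrt (X 0 \<omega>)\<bar> \<le> \<phi> g * ((1 + \<epsilon> / 2) * l)"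
              unfolding i(2) l_def by (rule bspec)
            also have "\<dots> \<le> \<phi> h * ((1 + \<epsilon> / 2) * l)"
              using g t h1 l \<epsilon> by (intro mult_right_mono phi_mono) auto
            finally show ?thesis .
          qed
          have "\<bar>sqrt (X t \<omega>) - sqrt (X g \<omega>)\<bar> \<le> \<delta> * \<phi> ((1/2) ^ n) * l"
            using elim(1) t h(2) by (auto simp: g_def l_def)
          also have "\<dots> \<le> \<delta> * (C * \<phi> h) * l"
            using C(2)[OF elim(5) h] \<delta> l by (intro mult_right_mono mult_left_mono) auto
          also have "\<dots> = \<epsilon> / 2 * \<phi> h * l" using C(1) by (simp add: \<delta>_def)
          finally have "\<bar>sqrt (X t \<omega>) - sqrt (X 0 \<omega>)\<bar> \<le> \<epsilon> / 2 * \<phi> h * l + \<phi> h * ((1 + \<epsilon> / 2) * l)"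
            using 1 by linarith
          also have "\<dots> = (1 + \<epsilon>) * \<phi> h * l" by (simp add: algebra_simps)
          also have "\<dots> \<le> (1 + \<epsilon>) * \<phi> h * sqrt (ln (ln (1 / h)))"
            using l \<epsilon> \<phi>h by (intro mult_left_mono) auto
          finally show "\<bar>sqrt (X t \<omega>) - sqrt (X 0 \<omega>)\<bar> \<le> (1 + \<epsilon>) * \<phi> h * sqrt (ln (ln (1 / h)))" .
        qed
      qed
    qed
  qed
qed

section \<open>Upper envelope when the kernel vanishes at the origin\<close>

text \<open>
  Analogous to the bound for the increments from 0, with the exact gamma tail in place of the
  increment tail, which yields \<open>u(g,g)\<close> in place of \<open>\<phi>(g)\<^sup>2\<close>.
\<close>

lemma grid_upper:
  assumes \<epsilon>: "0 < \<epsilon>" and pos: "eventually (\<lambda>t. 0 < u t t) (at_right 0)"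
  shows "AE \<omega> in M. eventually (\<lambda>n. \<forall>i\<in>{1..2 ^ m}.
    sqrt (X ((1/2) ^ n * (real i / 2 ^ m)) \<omega>)
      \<le> (1 + \<epsilon>) * sqrt (loglog n) * sqrt (u ((1/2) ^ n * (real i / 2 ^ m)) ((1/2) ^ n * (real i / 2 ^ m)))) sequentially"
proof -
  define \<theta> where "\<theta> = 1 / (1 + \<epsilon>)"
  have \<theta>: "0 < \<theta>" "\<theta> < 1" using \<epsilon> by (auto simp: \<theta>_def)
  obtain b where b: "0 < b" "\<And>t. 0 < t \<Longrightarrow> t < b \<Longrightarrow> 0 < u t t"
    using pos unfolding eventually_at_right_field by blast
  have "AE \<omega> in M. eventually (\<lambda>n. 
    sqrt (X ((1/2) ^ n * (real i / 2 ^ m)) \<omega>)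
      \<le> (1 + \<epsilon>) * sqrt (loglog n) * sqrt (u ((1/2) ^ n * (real i / 2 ^ m)) ((1/2) ^ n * (real i / 2 ^ m)))) sequentially"
    if i: "i \<in> {1..2 ^ m}" for i :: nat
  proof -
    define g where "g n = (1/2) ^ n * (real i / 2 ^ m)" for n
    have g: "g n \<in> {0..1}" "0 < g n" for n using grid_01[of i m n] i by (auto simp: g_def)
    have "g \<longlonglongrightarrow> 0 * (real i / 2 ^ m)"
      unfolding g_def by (intro tendsto_mult LIMSEQ_power_zero tendsto_const) auto
    then have gb: "eventually (\<lambda>n. g n < b) sequentially"
      using b(1) by (intro order_tendstoD) auto
    have [measurable]: "X (g n) \<in> borel_measurable M" for n
      using g by (auto intro!: X_meas)
    define z where "z n = (1 + \<epsilon>) * sqrt (loglog n)" for n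
    define A where "A n = {\<omega> \<in> space M. (z n)\<^sup>2 * u (g n) (g n) \<le> X (g n) \<omega>}" for n
    have "AE \<omega> in M. eventually (\<lambda>n. \<omega> \<notin> A n) sequentially"
    proof (rule borel_cantelli_loglog[where c = "1 + \<epsilon>" and K = "(1 - \<theta>) powr (- \<alpha>)"])
      show "A n \<in> events" for n unfolding A_def by measurable
      show "eventually (\<lambda>n. prob (A n) \<le> (1 - \<theta>) powr (- \<alpha>) * exp (- (1 + \<epsilon>) * loglog n)) sequentially"
        using loglog_pos gb
      proof eventually_elim
        case (elim n)
        have "0 < u (g n) (g n)" using b(2) g elim by blast
        then have "prob (A n) \<le> (1 - \<theta>) powr (- \<alpha>) * exp (- \<theta> * (z n)\<^sup>2)"
          unfolding A_def using g[of n] \<epsilon> elim(1) \<theta>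
          by (intro gamma_upper_tail[where a = "u (g n) (g n)"] X_nonneg X_laplace \<alpha> u_nonneg) (auto simp: z_def)
        also have "- \<theta> * (z n)\<^sup>2 = - (1 + \<epsilon>) * loglog n"
        proof -
          have "(z n)\<^sup>2 = (1 + \<epsilon>) * ((1 + \<epsilon>) * loglog n)"
            unfolding z_def power_mult_distrib using elim by (simp add: power2_eq_square)
          moreover have "1 / (1 + \<epsilon>) * ((1 + \<epsilon>) * ((1 + \<epsilon>) * loglog n)) = (1 + \<epsilon>) * loglog n"
            using \<epsilon> by simp
          ultimately show ?thesis unfolding \<theta>_def by (simp only: mult_minus_left)
        qed
        finally show ?case .
      qed
    qed (use \<epsilon> in auto)
    then show ?thesis
      using AE_space
    proof eventually_elim
      case (elim \<omega>)
      from elim(1) loglog_pos show ?case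
      proof eventually_elim
        case (elim n)
        have "X (g n) \<omega> \<le> (z n)\<^sup>2 * u (g n) (g n)" using elim(1) \<open>\<omega> \<in> space M\<close> by (auto simp: A_def)
        then have "sqrt (X (g n) \<omega>) \<le> sqrt ((z n)\<^sup>2 * u (g n) (g n))" by simp
        also have "\<dots> = z n * sqrt (u (g n) (g n))"
          using \<epsilon> elim(2) by (simp add: real_sqrt_mult z_def)
        finally show ?case by (simp add: g_def z_def)
      qed
    qed
  qed
  then have "AE \<omega> in M. \<forall>i\<in>{1..2 ^ m}. eventually (\<lambda>n. 
    sqrt (X ((1/2) ^ n * (real i / 2 ^ m)) \<omega>)
      \<le> (1 + \<epsilon>) * sqrt (loglog n) * sqrt (u ((1/2) ^ n * (real i / 2 ^ m)) ((1/2) ^ n * (real i / 2 ^ m)))) sequentially"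
    by (intro AE_finite_allI) auto
  then show ?thesis by eventually_elim (rule eventually_ball_finite, auto)
qed

lemma X_0_eq_0:
  assumes "u 0 0 = 0"
  shows "AE \<omega> in M. X 0 \<omega> = 0"
proof -
  have [measurable]: "X 0 \<in> borel_measurable M" by (rule X_meas) simp
  have int: "integrable M (\<lambda>\<omega>. exp (- 1 * X 0 \<omega>))"
    by (intro integrable_const_bound[where B = 1] AE_I2) (use X_nonneg[of 0] in auto)
  have "(\<integral>\<omega>. 1 - exp (- 1 * X 0 \<omega>) \<partial>M) = 0"
    using X_laplace[of 0 1] assms int by (subst Bochner_Integration.integral_diff) (auto simp: prob_space)
  moreover have "AE \<omega> in M. 0 \<le> 1 - exp (- 1 * X 0 \<omega>)"
    using X_nonneg[of 0] by (intro AE_I2) auto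
  ultimately have "AE \<omega> in M. 1 - exp (- 1 * X 0 \<omega>) = 0"
    using int by (subst (asm) integral_nonneg_eq_0_iff_AE) auto
  then show ?thesis by eventually_elim auto
qed

text \<open>
  The point \<open>g\<close> is the grid point next to \<open>t\<close> on its left. Its distance to \<open>t\<close> is recorded because
  the value \<open>u(g,g)\<close> must later be compared with the diagonal at \<open>t\<close>.
\<close>

lemma sqrt_upper_envelope:
  assumes \<epsilon>: "0 < \<epsilon>" and u0: "u 0 0 = 0" and pos: "eventually (\<lambda>t. 0 < u t t) (at_right 0)"
  shows "AE \<omega> in M. eventually (\<lambda>h. \<forall>t\<in>{0..h}. \<exists>g\<in>{0..t}. \<phi> (t - g) \<le> \<epsilon> * \<phi> h \<and>
    sqrt (X t \<omega>) \<le> ((1 + \<epsilon>) * sqrt (u g g) + \<epsilon> * \<phi> h) * sqrt (ln (ln (1 / h)))) (at_right 0)"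
proof -
  obtain r C N where r: "0 < r" "r < 1" and C: "0 < C"
    and decay: "\<And>n k. N \<le> n \<Longrightarrow> \<phi> ((1/2) ^ (n + k)) \<le> r ^ k * \<phi> ((1/2) ^ n)"
    and \<phi>C: "\<And>n h. N \<le> n \<Longrightarrow> (1/2) ^ Suc n < h \<Longrightarrow> h \<le> (1/2) ^ n \<Longrightarrow> \<phi> ((1/2) ^ n) \<le> C * \<phi> h"
    using phi_dyadic by metis
  define \<delta> where "\<delta> = \<epsilon> / C"
  have \<delta>: "0 < \<delta>" using \<epsilon> C by (simp add: \<delta>_def)
  obtain m0 where m0: "\<And>m. m0 \<le> m \<Longrightarrow> AE \<omega> in M. eventually (\<lambda>n. \<forall>t\<in>{0..(1/2) ^ n}.
    \<bar>sqrt (X t \<omega>) - sqrt (X (grid (n + m) t) \<omega>)\<bar> \<le> \<delta> * \<phi> ((1/2) ^ n) * sqrt (loglog n)) sequentially"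
    using local_modulus[OF \<delta>] by blast
  obtain m1 where m1: "r ^ m1 < \<delta>" using real_arch_pow_inv[OF \<delta> r(2)] by blast
  define m where "m = max m0 m1"
  have "r ^ m \<le> r ^ m1" using r by (intro power_decreasing) (auto simp: m_def)
  then have rm: "r ^ m \<le> \<delta>" using m1 by linarith
  have "m0 \<le> m" by (simp add: m_def)
  from m0[OF this] grid_upper[OF \<epsilon> pos, of m] X_0_eq_0[OF u0] show ?thesis
  proof eventually_elim
    case (elim \<omega>)
    show ?case
    proof (rule eventually_at_right_dyadic)
      show "eventually (\<lambda>n. \<forall>h. (1/2) ^ Suc n < h \<longrightarrow> h \<le> (1/2) ^ n \<longrightarrow>
          (\<forall>t\<in>{0..h}. \<exists>g\<in>{0..t}. \<phi> (t - g) \<le> \<epsilon> * \<phi> h \<and>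
            sqrt (X t \<omega>) \<le> ((1 + \<epsilon>) * sqrt (u g g) + \<epsilon> * \<phi> h) * sqrt (ln (ln (1 / h))))) sequentially"
        using elim(1,2) loglog_pos eventually_gt_at_top[of 0] eventually_ge_at_top[of N]
      proof eventually_elim
        case (elim n)
        show ?case
        proof (intro allI impI ballI)
          fix h t :: real assume h: "(1/2) ^ Suc n < h" "h \<le> (1/2) ^ n" and t: "t \<in> {0..h}"
          have h0: "0 < h" using h(1) zero_less_power[of "1/2::real" "Suc n"] by linarith
          have h1: "h \<le> 1" using h(2) power_le_one[of "1/2::real" n] by linarith
          define g where "g = grid (n + m) t"
          define l where "l = sqrt (loglog n)"
          have l: "0 \<le> l" "l \<le> sqrt (ln (ln (1 / h)))"
            using loglog_mono_scale[OF elim(3,4) h0 h(2)] elim(3) by (auto simp: l_def)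
          have g: "0 \<le> g" "g \<le> t" "t - g \<le> (1/2) ^ (n + m)"
            using grid_bounds[of t "n + m"] t by (auto simp: g_def)
          have \<phi>h: "0 < \<phi> h" by (rule phi_pos) fact+
          have \<phi>n: "\<delta> * \<phi> ((1/2) ^ n) \<le> \<epsilon> * \<phi> h"
          proof -
            have "\<delta> * \<phi> ((1/2) ^ n) \<le> \<delta> * (C * \<phi> h)"
              using \<phi>C[OF elim(5) h] \<delta> by (intro mult_left_mono) auto
            also have "\<dots> = \<epsilon> * \<phi> h" using C by (simp add: \<delta>_def)
            finally show ?thesis .
          qed
          have "\<phi> (t - g) \<le> \<phi> ((1/2) ^ (n + m))"
            using g by (intro phi_mono power_le_one) auto
          also have "\<dots> \<le> r ^ m * \<phi> ((1/2) ^ n)" by (rule decay) fact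
          also have "\<dots> \<le> \<delta> * \<phi> ((1/2) ^ n)"
            using rm phi_pos[of "(1/2) ^ n"] by (intro mult_right_mono) (auto simp: power_le_one)
          finally have \<phi>tg: "\<phi> (t - g) \<le> \<epsilon> * \<phi> h" using \<phi>n by linarith
          have g01: "g \<in> {0..1}" using g t h1 by auto
          have 1: "sqrt (X g \<omega>) \<le> (1 + \<epsilon>) * l * sqrt (u g g)"
          proof (cases "g = 0")
            case True
            then show ?thesis using \<open>X 0 \<omega> = 0\<close> u0 by simp
          next
            case False
            have "0 \<le> t" "t \<le> (1/2) ^ n" using t h by auto
            then obtain i where i: "i \<le> 2 ^ m" "g = (1/2) ^ n * (real i / 2 ^ m)"
              unfolding g_def by (rule grid_point)
            then have "i \<in> {1..2 ^ m}" using False by (cases i) auto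
            with elim(2) show ?thesis unfolding i(2) l_def by (rule bspec)
          qed
          have "\<bar>sqrt (X t \<omega>) - sqrt (X g \<omega>)\<bar> \<le> \<delta> * \<phi> ((1/2) ^ n) * l"
            using elim(1) t h(2) by (auto simp: g_def l_def)
          also have "\<dots> \<le> \<epsilon> * \<phi> h * l" using \<phi>n l by (intro mult_right_mono) auto
          finally have "sqrt (X t \<omega>) \<le> (1 + \<epsilon>) * l * sqrt (u g g) + \<epsilon> * \<phi> h * l" using 1 by linarith
          also have "\<dots> = ((1 + \<epsilon>) * sqrt (u g g) + \<epsilon> * \<phi> h) * l" by (simp add: algebra_simps)
          also have "\<dots> \<le> ((1 + \<epsilon>) * sqrt (u g g) + \<epsilon> * \<phi> h) * sqrt (ln (ln (1 / h)))"
            using l \<epsilon> \<phi>h u_nonneg[OF g01] by (intro mult_left_mono) auto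
          finally show "\<exists>g\<in>{0..t}. \<phi> (t - g) \<le> \<epsilon> * \<phi> h \<and>
              sqrt (X t \<omega>) \<le> ((1 + \<epsilon>) * sqrt (u g g) + \<epsilon> * \<phi> h) * sqrt (ln (ln (1 / h)))"
            using \<phi>tg g by (intro bexI[of _ g]) auto
        qed
      qed
    qed
  qed
qed

section \<open>Limits superior\<close>

lemma small_scale: "eventually (\<lambda>h. 0 < h \<and> h \<le> 1 \<and> 0 < \<phi> h \<and> 0 < sqrt (ln (ln (1 / h)))) (at_right 0)"
proof -
  have "0 < h \<and> h \<le> 1 \<and> 0 < \<phi> h \<and> 0 < sqrt (ln (ln (1 / h)))" if "0 < h" "h < 1/4" for h
    using that phi_pos[of h] loglog_inverse_pos[of h] by simp
  then show ?thesis unfolding eventually_at_right_field by (intro exI[of _ "1/4"]) auto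
qed

lemma limsup_increment:
  "AE \<omega> in M. Limsup (at_right 0) (\<lambda>h. SUP t\<in>{0..h}.
     ereal (\<bar>X t \<omega> - X 0 \<omega>\<bar> / (\<phi> h * sqrt (ln (ln (1 / h)))))) \<le> ereal (2 * sqrt (X 0 \<omega>))"
proof -
  define \<epsilon> where "\<epsilon> k = 1 / real (Suc k)" for k
  have \<epsilon>: "0 < \<epsilon> k" for k by (simp add: \<epsilon>_def)
  have \<epsilon>_lim: "\<epsilon> \<longlonglongrightarrow> 0" unfolding \<epsilon>_def by (rule LIMSEQ_Suc[OF lim_1_over_n])
  have "AE \<omega> in M. \<forall>k. eventually (\<lambda>h. \<forall>t\<in>{0..h}.
    \<bar>sqrt (X t \<omega>) - sqrt (X 0 \<omega>)\<bar> \<le> (1 + \<epsilon> k) * \<phi> h * sqrt (ln (ln (1 / h)))) (at_right 0)"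
    unfolding AE_all_countable using sqrt_increment_loglog[OF \<epsilon>] by blast
  then show ?thesis
    using AE_space
  proof eventually_elim
    case (elim \<omega>)
    show ?case
    proof (rule Limsup_le_limit)
      have "(\<lambda>k. (1 + \<epsilon> k) * (2 * sqrt (X 0 \<omega>) + \<epsilon> k)) \<longlonglongrightarrow> (1 + 0) * (2 * sqrt (X 0 \<omega>) + 0)"
        by (intro tendsto_intros \<epsilon>_lim)
      then show "(\<lambda>k. (1 + \<epsilon> k) * (2 * sqrt (X 0 \<omega>) + \<epsilon> k)) \<longlonglongrightarrow> 2 * sqrt (X 0 \<omega>)" by simp
      fix k
      have "continuous_on {0..1} (\<lambda>t. sqrt (X t \<omega>))"
        using paths[OF elim(2)] by (intro continuous_intros)
      then obtain d where d: "0 < d" "\<And>t. t \<in> {0..1} \<Longrightarrow> dist t 0 < d \<Longrightarrow> dist (sqrt (X t \<omega>)) (sqrt (X 0 \<omega>)) < \<epsilon> k"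
        using \<epsilon>[of k] unfolding continuous_on_iff by (metis atLeastAtMost_iff order_refl zero_le_one)
      have "eventually (\<lambda>h. h < d) (at_right 0)"
        using d(1) unfolding eventually_at_right_field by (intro exI[of _ d]) auto
      with elim(1)[rule_format, of k] small_scale
      show "eventually (\<lambda>h. (SUP t\<in>{0..h}. ereal (\<bar>X t \<omega> - X 0 \<omega>\<bar> / (\<phi> h * sqrt (ln (ln (1 / h))))))
          \<le> ereal ((1 + \<epsilon> k) * (2 * sqrt (X 0 \<omega>) + \<epsilon> k))) (at_right 0)"
      proof eventually_elim
        case (elim h)
        define l where "l = sqrt (ln (ln (1 / h)))"
        have h: "0 < h" "h \<le> 1" "0 < \<phi> h" "0 < l" using elim(2) by (auto simp: l_def)
        show ?case
        proof (rule SUP_least)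
          fix t assume t: "t \<in> {0..h}"
          then have t01: "t \<in> {0..1}" using h by auto
          have X: "0 \<le> X t \<omega>" "0 \<le> X 0 \<omega>"
            using X_nonneg[OF t01 \<open>\<omega> \<in> space M\<close>] X_nonneg[of 0, OF _ \<open>\<omega> \<in> space M\<close>] by auto
          then have nn: "0 \<le> sqrt (X t \<omega>)" "0 \<le> sqrt (X 0 \<omega>)" by auto
          have "dist (sqrt (X t \<omega>)) (sqrt (X 0 \<omega>)) < \<epsilon> k"
            using t elim(3) by (intro d(2) t01) auto
          then have near: "sqrt (X t \<omega>) \<le> sqrt (X 0 \<omega>) + \<epsilon> k" by (simp add: dist_real_def)
          have "\<bar>a\<^sup>2 - b\<^sup>2\<bar> = \<bar>a - b\<bar> * (a + b)" if "0 \<le> a" "0 \<le> b" for a b :: real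
            using that by (simp add: power2_eq_square square_diff_square_factored abs_mult)
          from this[OF nn] have "\<bar>X t \<omega> - X 0 \<omega>\<bar> = \<bar>sqrt (X t \<omega>) - sqrt (X 0 \<omega>)\<bar> * (sqrt (X t \<omega>) + sqrt (X 0 \<omega>))"
            using X by simp
          also have "\<dots> \<le> ((1 + \<epsilon> k) * \<phi> h * l) * (2 * sqrt (X 0 \<omega>) + \<epsilon> k)"
            using elim(1) t near nn h \<epsilon>[of k] by (intro mult_mono) (auto simp: l_def)
          finally have "\<bar>X t \<omega> - X 0 \<omega>\<bar> / (\<phi> h * l) \<le> (1 + \<epsilon> k) * (2 * sqrt (X 0 \<omega>) + \<epsilon> k)"
            using h by (simp add: pos_divide_le_eq mult_ac)
          then show "ereal (\<bar>X t \<omega> - X 0 \<omega>\<bar> / (\<phi> h * sqrt (ln (ln (1 / h)))))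
              \<le> ereal ((1 + \<epsilon> k) * (2 * sqrt (X 0 \<omega>) + \<epsilon> k))" by (simp add: l_def)
        qed
      qed
    qed
  qed
qed

text \<open>
  The increment bound for \<open>\<surd>u\<close> bounds the diagonal on the unit interval, so the real supremum is a
  genuine one.
\<close>

lemma u_star_upper:
  assumes "0 \<le> t" "t \<le> h" "t \<le> 1"
  shows "u t t \<le> u_star u h"
  unfolding u_star_def
proof (rule cSUP_upper)
  have "u s s \<le> (sqrt (u 0 0) + \<phi> 1)\<^sup>2" if "s \<in> {0..1}" for s
  proof -
    have "\<bar>sqrt (u 0 0) - sqrt (u s s)\<bar> \<le> \<phi> \<bar>s - 0\<bar>" by (rule sqrt_u_diff_le) (use that in auto)
    also have "\<dots> \<le> \<phi> 1" using that by (intro phi_mono) auto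
    finally have "sqrt (u s s) \<le> sqrt (u 0 0) + \<phi> 1" by linarith
    then show ?thesis by (rule sqrt_le_D)
  qed
  then show "bdd_above ((\<lambda>t. u t t) ` {t \<in> {0..1}. t \<le> h})" by (intro bdd_aboveI2) auto
qed (use assms in auto)

context
  fixes B :: real
  assumes u0: "u 0 0 = 0" and B: "0 \<le> B" "eventually (\<lambda>h. \<phi> h \<le> B * sqrt (u h h)) (at_right 0)"
begin

lemma u_pos: "eventually (\<lambda>h. 0 < u h h) (at_right 0)"
  using B(2) small_scale
proof eventually_elim
  case (elim h)
  then have "0 < B * sqrt (u h h)" by linarith
  then show ?case using B(1) by (simp add: zero_less_mult_iff)
qed

lemma limsup_at_diagonal:
  "AE \<omega> in M. Limsup (at_right 0) (\<lambda>t. ereal (X t \<omega> / (u t t * ln (ln (1 / t))))) \<le> 1"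
proof -
  define \<epsilon> where "\<epsilon> k = 1 / real (Suc k)" for k
  have \<epsilon>: "0 < \<epsilon> k" for k by (simp add: \<epsilon>_def)
  have \<epsilon>_lim: "\<epsilon> \<longlonglongrightarrow> 0" unfolding \<epsilon>_def by (rule LIMSEQ_Suc[OF lim_1_over_n])
  \<comment> \<open>The inner factor pays for replacing \<open>u(g,g)\<close> by \<open>u(h,h)\<close>, the last summand for the chaining remainder.\<close>
  define c where "c k = (1 + \<epsilon> k) * (1 + \<epsilon> k * B) + \<epsilon> k * B" for k
  have "(\<lambda>k. (c k)\<^sup>2) \<longlonglongrightarrow> ((1 + 0) * (1 + 0 * B) + 0 * B)\<^sup>2"
    unfolding c_def by (intro tendsto_intros \<epsilon>_lim)
  then have c_lim: "(\<lambda>k. (c k)\<^sup>2) \<longlonglongrightarrow> 1" by simp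
  have "AE \<omega> in M. \<forall>k. eventually (\<lambda>h. \<forall>t\<in>{0..h}. \<exists>g\<in>{0..t}. \<phi> (t - g) \<le> \<epsilon> k * \<phi> h \<and>
    sqrt (X t \<omega>) \<le> ((1 + \<epsilon> k) * sqrt (u g g) + \<epsilon> k * \<phi> h) * sqrt (ln (ln (1 / h)))) (at_right 0)"
    unfolding AE_all_countable using sqrt_upper_envelope[OF \<epsilon> u0 u_pos] by blast
  then have "AE \<omega> in M. Limsup (at_right 0) (\<lambda>t. ereal (X t \<omega> / (u t t * ln (ln (1 / t))))) \<le> ereal 1"
    using AE_space
  proof eventually_elim
    case (elim \<omega>)
    show ?case
    proof (rule Limsup_le_limit[OF _ c_lim])
      fix k
      from elim(1)[rule_format, of k] small_scale B(2) u_pos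
      show "eventually (\<lambda>h. ereal (X h \<omega> / (u h h * ln (ln (1 / h)))) \<le> ereal ((c k)\<^sup>2)) (at_right 0)"
      proof eventually_elim
        case (elim h)
        define l where "l = sqrt (ln (ln (1 / h)))"
        have h: "h \<in> {0..1}" "0 < l" using elim(2) by (auto simp: l_def)
        have "h \<in> {0..h}" using h by simp
        with elim(1) obtain g where g: "g \<in> {0..h}" "\<phi> (h - g) \<le> \<epsilon> k * \<phi> h"
          "sqrt (X h \<omega>) \<le> ((1 + \<epsilon> k) * sqrt (u g g) + \<epsilon> k * \<phi> h) * l" unfolding l_def by blast
        have \<epsilon>\<phi>: "\<epsilon> k * \<phi> h \<le> \<epsilon> k * (B * sqrt (u h h))"
          using elim(3) \<epsilon>[of k] by (intro mult_left_mono) auto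
        have "\<bar>sqrt (u g g) - sqrt (u h h)\<bar> \<le> \<phi> \<bar>h - g\<bar>" using g h by (intro sqrt_u_diff_le) auto
        then have "sqrt (u g g) \<le> sqrt (u h h) + \<epsilon> k * (B * sqrt (u h h))"
          using g(1,2) \<epsilon>\<phi> by simp
        then have "(1 + \<epsilon> k) * sqrt (u g g) + \<epsilon> k * \<phi> h
            \<le> (1 + \<epsilon> k) * (sqrt (u h h) + \<epsilon> k * (B * sqrt (u h h))) + \<epsilon> k * (B * sqrt (u h h))"
          using \<epsilon>\<phi> \<epsilon>[of k] by (intro add_mono mult_left_mono) auto
        also have "\<dots> = c k * sqrt (u h h)" by (simp add: c_def algebra_simps)
        finally have "((1 + \<epsilon> k) * sqrt (u g g) + \<epsilon> k * \<phi> h) * l \<le> c k * sqrt (u h h) * l"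
          using h(2) by (intro mult_right_mono) auto
        then have "sqrt (X h \<omega>) \<le> c k * sqrt (u h h) * l" using g(3) by linarith
        then have "X h \<omega> / (u h h * ln (ln (1 / h))) \<le> (c k)\<^sup>2"
          using elim(2,4) X_nonneg[OF h(1) \<open>\<omega> \<in> space M\<close>] unfolding l_def by (intro ratio_le_square) auto
        then show ?case by simp
      qed
    qed
  qed
  then show ?thesis by (simp only: one_ereal_def)
qed

lemma limsup_at_u_star:
  "AE \<omega> in M. Limsup (at_right 0) (\<lambda>h. SUP t\<in>{0..h}. ereal (X t \<omega> / (u_star u h * ln (ln (1 / h))))) \<le> 1"
proof -
  define \<epsilon> where "\<epsilon> k = 1 / real (Suc k)" for k
  have \<epsilon>: "0 < \<epsilon> k" for k by (simp add: \<epsilon>_def)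
  have \<epsilon>_lim: "\<epsilon> \<longlonglongrightarrow> 0" unfolding \<epsilon>_def by (rule LIMSEQ_Suc[OF lim_1_over_n])
  define c where "c k = (1 + \<epsilon> k) + \<epsilon> k * B" for k
  have "(\<lambda>k. (c k)\<^sup>2) \<longlonglongrightarrow> ((1 + 0) + 0 * B)\<^sup>2"
    unfolding c_def by (intro tendsto_intros \<epsilon>_lim)
  then have c_lim: "(\<lambda>k. (c k)\<^sup>2) \<longlonglongrightarrow> 1" by simp
  have "AE \<omega> in M. \<forall>k. eventually (\<lambda>h. \<forall>t\<in>{0..h}. \<exists>g\<in>{0..t}. \<phi> (t - g) \<le> \<epsilon> k * \<phi> h \<and>
    sqrt (X t \<omega>) \<le> ((1 + \<epsilon> k) * sqrt (u g g) + \<epsilon> k * \<phi> h) * sqrt (ln (ln (1 / h)))) (at_right 0)"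
    unfolding AE_all_countable using sqrt_upper_envelope[OF \<epsilon> u0 u_pos] by blast
  then have "AE \<omega> in M. Limsup (at_right 0)
      (\<lambda>h. SUP t\<in>{0..h}. ereal (X t \<omega> / (u_star u h * ln (ln (1 / h))))) \<le> ereal 1"
    using AE_space
  proof eventually_elim
    case (elim \<omega>)
    show ?case
    proof (rule Limsup_le_limit[OF _ c_lim])
      fix k
      from elim(1)[rule_format, of k] small_scale B(2) u_pos
      show "eventually (\<lambda>h. (SUP t\<in>{0..h}. ereal (X t \<omega> / (u_star u h * ln (ln (1 / h))))) \<le> ereal ((c k)\<^sup>2))
          (at_right 0)"
      proof eventually_elim
        case (elim h)
        define l where "l = sqrt (ln (ln (1 / h)))"
        have h: "0 < h" "h \<le> 1" "0 < l" using elim(2) by (auto simp: l_def)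
        have uh: "u h h \<le> u_star u h" using h by (intro u_star_upper) auto
        then have us: "0 < u_star u h" using elim(4) by linarith
        show ?case
        proof (rule SUP_least)
          fix t assume t: "t \<in> {0..h}"
          with elim(1) obtain g where g: "g \<in> {0..t}"
            "sqrt (X t \<omega>) \<le> ((1 + \<epsilon> k) * sqrt (u g g) + \<epsilon> k * \<phi> h) * l" unfolding l_def by blast
          have "u g g \<le> u_star u h" using g t h by (intro u_star_upper) auto
          moreover have "\<phi> h \<le> B * sqrt (u_star u h)"
            using elim(3) mult_left_mono[OF real_sqrt_le_mono[OF uh] B(1)] by linarith
          ultimately have "(1 + \<epsilon> k) * sqrt (u g g) + \<epsilon> k * \<phi> h
              \<le> (1 + \<epsilon> k) * sqrt (u_star u h) + \<epsilon> k * (B * sqrt (u_star u h))"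
            using \<epsilon>[of k] by (intro add_mono mult_left_mono) auto
          also have "\<dots> = c k * sqrt (u_star u h)" by (simp add: c_def algebra_simps)
          finally have "((1 + \<epsilon> k) * sqrt (u g g) + \<epsilon> k * \<phi> h) * l \<le> c k * sqrt (u_star u h) * l"
            using h(3) by (intro mult_right_mono) auto
          then have "sqrt (X t \<omega>) \<le> c k * sqrt (u_star u h) * l" using g(2) by linarith
          then have "X t \<omega> / (u_star u h * ln (ln (1 / h))) \<le> (c k)\<^sup>2"
            using elim(2) us X_nonneg[of t \<omega>] t h \<open>\<omega> \<in> space M\<close> unfolding l_def
            by (intro ratio_le_square) auto
          then show "ereal (X t \<omega> / (u_star u h * ln (ln (1 / h)))) \<le> ereal ((c k)\<^sup>2)" by simp
        qed
      qed
    qed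
  qed
  then show ?thesis by (simp only: one_ereal_def)
qed

end

lemma phi_le_sqrt_u:
  assumes "(\<lambda>h. (\<phi> h)\<^sup>2) \<in> O[at_right 0](\<lambda>h. u h h)"
  obtains B where "0 \<le> B" "eventually (\<lambda>h. \<phi> h \<le> B * sqrt (u h h)) (at_right 0)"
proof -
  obtain c where c: "0 < c" "eventually (\<lambda>h. norm ((\<phi> h)\<^sup>2) \<le> c * norm (u h h)) (at_right 0)"
    using assms by (elim landau_o.bigE)
  have "eventually (\<lambda>h. \<phi> h \<le> sqrt c * sqrt (u h h)) (at_right 0)"
    using c(2) small_scale
  proof eventually_elim
    case (elim h)
    then have "(\<phi> h)\<^sup>2 \<le> c * u h h" using u_nonneg[of h] by simp
    then show ?case by (simp add: real_le_rsqrt flip: real_sqrt_mult)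
  qed
  then show thesis using c(1) by (intro that[of "sqrt c"]) auto
qed

end

theorem theorem1p2:
  fixes M :: "'a measure"
    and \<alpha> :: real
    and X :: "real \<Rightarrow> 'a \<Rightarrow> real"
    and u :: "real \<Rightarrow> real \<Rightarrow> real"
    and \<phi> :: "real \<Rightarrow> real"
  assumes "prob_space M"
    and "\<alpha> > 0"
    and "permanental_process M \<alpha> {0..1} X u"
    and "\<forall>\<omega>\<in>space M. continuous_on {0..1} (\<lambda>t. X t \<omega>)"
    and "\<forall>\<delta>>0. u_star u \<delta> > 0"
    and "mono_on {0..1} \<phi>"
    and "\<forall>s\<in>{0..1}. \<forall>t\<in>{0..1}. sigma_fun u s t \<le> \<phi> \<bar>t - s\<bar>"
    and "(\<integral>\<^sup>+x\<in>{0<..1/2}. ennreal (\<phi> x / (x * sqrt (ln (1 / x)))) \<partial>lborel) < \<infinity>"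
    and "\<exists>\<rho>>0. regularly_varying_at_zero \<phi> \<rho>"
  shows "(AE \<omega> in M.
            Limsup (at_right 0) (\<lambda>h. SUP t\<in>{0..h}.
              ereal (\<bar>X t \<omega> - X 0 \<omega>\<bar> / (\<phi> h * sqrt (ln (ln (1 / h))))))
            \<le> ereal (2 * sqrt (X 0 \<omega>))) \<and>
         (u 0 0 = 0 \<and> (\<lambda>h. (\<phi> h)\<^sup>2) \<in> O[at_right 0](\<lambda>h. u h h) \<longrightarrow>
           (AE \<omega> in M.
              Limsup (at_right 0) (\<lambda>t. ereal (X t \<omega> / (u t t * ln (ln (1 / t))))) \<le> 1) \<and>
           (AE \<omega> in M.
              Limsup (at_right 0) (\<lambda>h. SUP t\<in>{0..h}.
                ereal (X t \<omega> / (u_star u h * ln (ln (1 / h))))) \<le> 1))"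
proof -
  obtain \<rho> where \<rho>: "0 < \<rho>" "regularly_varying_at_zero \<phi> \<rho>" using assms(9) by blast
  interpret prob_space M by fact
  interpret permanental_path M \<alpha> X u \<phi> \<rho>
    using assms(2-4,6,7) \<rho> by unfold_locales auto
  show ?thesis
  proof (intro conjI impI; (elim conjE)?)
    show "AE \<omega> in M. Limsup (at_right 0) (\<lambda>h. SUP t\<in>{0..h}.
        ereal (\<bar>X t \<omega> - X 0 \<omega>\<bar> / (\<phi> h * sqrt (ln (ln (1 / h)))))) \<le> ereal (2 * sqrt (X 0 \<omega>))"
      by (rule limsup_increment)
  next
    assume u0: "u 0 0 = 0" and O: "(\<lambda>h. (\<phi> h)\<^sup>2) \<in> O[at_right 0](\<lambda>h. u h h)"
    obtain B where B: "0 \<le> B" "eventually (\<lambda>h. \<phi> h \<le> B * sqrt (u h h)) (at_right 0)"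
      using phi_le_sqrt_u[OF O] .
    show "AE \<omega> in M. Limsup (at_right 0) (\<lambda>t. ereal (X t \<omega> / (u t t * ln (ln (1 / t))))) \<le> 1"
      by (rule limsup_at_diagonal[OF u0 B])
    show "AE \<omega> in M. Limsup (at_right 0) (\<lambda>h. SUP t\<in>{0..h}.
        ereal (X t \<omega> / (u_star u h * ln (ln (1 / h))))) \<le> 1"
      by (rule limsup_at_u_star[OF u0 B])
  qed
qed

end
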